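(* Let $\mathcal{SC}(Q,w)$ be a non-empty subword complex of type $A$. Every face $F$ of the brick polyhedron $\mathcal{B}(Q,w)$ is of the form $\mathcal{B}^I(Q,w)$ for some face $I\in\mathcal{SC}(Q,w)$.
   Context: **Type $A$ conventions.** $W=\mathcal{S}_{n+1}$ is generated by $S=\{s_1,\dots,s_n\}$, $s_p=(p\;\,p{+}1)$, and acts linearly on $V=\mathbb{R}^{n+1}$ by $w(e_i)=e_{w(i)}$. Roots: $\Phi=\{e_p-e_q\mid p\ne q\}$, positive roots $\Phi^+=\{e_i-e_j\mid i<j\}$, simple roots $\alpha_p=e_p-e_{p+1}$ (also written $\alpha_{s_p}$), fundamental weights $\omega_p=\sum_{q\le p}e_q$ (also written $\omega_{s_p}$). For $\beta\in\Phi$, $s_\beta$ is the corresponding reflection. $\le_B$ is the Bruhat order and $\prec_B$ its cover relation. **Subword complexes.** For a word $Q=(q_1,\dots,q_m)$ in $S$ and $w\in W$, $\mathcal{SC}(Q,w)$ is the simplicial complex whose facets are the sets $I\subseteq[m]$ such that the subword $Q_{[m]\setminus I}$ is a reduced expression of $w$. For a facet $J$ and $k\in[m]$, the root function and weight function are $r(J,k)=\left(\prod Q_{\{1,\dots,k-1\}\setminus J}\right)(\alpha_{q_k})$ and $\omega(J,k)=\left(\prod Q_{\{1,\dots,k-1\}\setminus J}\right)(\omega_{q_k})$, where $\prod Q_X$ is the product, in order, of the letters at positions $X$. **Brick polyhedron.** $\operatorname{Dem}(Q)=\max_{\le_B}\{\prod Q_X\mid X\subseteq[m]\}$; the brick vector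 is $b(J)=-\sum_{k=1}^m\omega(J,k)$; and $\mathcal{B}(Q,w)=\operatorname{conv}\{b(J)\mid J\text{ facet of }\mathcal{SC}(Q,w)\}+\operatorname{cone}\{\beta\in\Phi^+\mid w\prec_B s_\beta w\le_B\operatorname{Dem}(Q)\}$ (Minkowski sum). **Modified brick polyhedron.** For a face $I\in\mathcal{SC}(Q,w)$, let $\mathcal{SC}^I(Q,w)$ be the set of facets $J$ of $\mathcal{SC}(Q,w)$ with $I\subseteq J$; for such $J$ let $R^I(J)=\{r(J,j)\mid j\in J\setminus I\}$; let $\mathcal{C}^{I,+}=\bigcap_{J\in\mathcal{SC}^I(Q,w)}\operatorname{cone}R^I(J)$ (with $\operatorname{cone}\emptyset=\{0\}$). Then $\mathcal{B}^I(Q,w)=\operatorname{conv}\{b(J)\mid J\in\mathcal{SC}^I(Q,w)\}+\mathcal{C}^{I,+}$. Faces of polyhedra are understood to be non-empty (the polyhedron itself counts as a face). *)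

theory Defs
  imports "HOL-Analysis.Analysis"
begin

text \<open>
  The index set \<open>{1, \<dots>, n + 1}\<close> is an arbitrary finite linearly ordered type \<open>'n\<close> with
  \<open>n + 1\<close> elements. Thus \<open>V\<close> is \<^typ>\<open>real ^ 'n\<close> (written \<open>(real, 'n) vec\<close>, since the notation
  \<open>real ^ 'n\<close> fixes the sort of \<open>'n\<close> to \<open>finite\<close>), \<open>W\<close> consists of the permutations of \<open>'n\<close>, and the
  simple reflections are indexed by the non-maximal elements of \<open>'n\<close>.
\<close>

definition sym_group :: "('n::finite \<Rightarrow> 'n) set"
  where "sym_group = {w. w permutes UNIV}"

definition std_basis :: "'n::finite \<Rightarrow> (real, 'n) vec"
  where "std_basis i = axis i 1"

definition act :: "('n::finite \<Rightarrow> 'n) \<Rightarrow> (real, 'n) vec \<Rightarrow> (real, 'n) vec"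
  where "act w v = (\<Sum>i\<in>UNIV. (v $ i) *\<^sub>R std_basis (w i))"

definition simple_indices :: "'n::{finite,linorder} set"
  where "simple_indices = {p. \<exists>q. p < q}"

text \<open>The element \<open>p + 1\<close>; unspecified if \<open>p\<close> is maximal.\<close>

definition next_index :: "'n::{finite,linorder} \<Rightarrow> 'n"
  where "next_index p = Min {q. p < q}"

definition simple_refl :: "'n::{finite,linorder} \<Rightarrow> 'n \<Rightarrow> 'n"
  where "simple_refl p = Transposition.transpose p (next_index p)"

definition simple_root :: "'n::{finite,linorder} \<Rightarrow> (real, 'n) vec"
  where "simple_root p = std_basis p - std_basis (next_index p)"

definition fund_weight :: "'n::{finite,linorder} \<Rightarrow> (real, 'n) vec"
  where "fund_weight p = (\<Sum>q\<in>{..p}. std_basis q)"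

definition roots :: "((real, 'n::finite) vec) set"
  where "roots = {std_basis p - std_basis q | p q. p \<noteq> q}"

definition pos_roots :: "((real, 'n::{finite,linorder}) vec) set"
  where "pos_roots = {std_basis i - std_basis j | i j. i < j}"

definition refl_map :: "(real, 'n::finite) vec \<Rightarrow> (real, 'n) vec \<Rightarrow> (real, 'n) vec"
  where "refl_map \<beta> v = v - (2 * (v \<bullet> \<beta>) / (\<beta> \<bullet> \<beta>)) *\<^sub>R \<beta>"

text \<open>
  The reflection in a root as a group element; by \<open>root_refl_eq\<close> below, it is a transposition.
\<close>

definition root_refl :: "(real, 'n::finite) vec \<Rightarrow> 'n \<Rightarrow> 'n"
  where "root_refl \<beta> = (THE w. w \<in> sym_group \<and> act w = refl_map \<beta>)"

text \<open>A word is a list of indices \<open>p\<close>, standing for the letters \<open>s\<^sub>p\<close>.\<close>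

definition word_prod :: "'n::{finite,linorder} list \<Rightarrow> 'n \<Rightarrow> 'n"
  where "word_prod Q = foldr (\<circ>) (map simple_refl Q) id"

definition cox_length :: "('n::{finite,linorder} \<Rightarrow> 'n) \<Rightarrow> nat"
  where "cox_length w =
    (LEAST k. \<exists>Q. set Q \<subseteq> simple_indices \<and> length Q = k \<and> word_prod Q = w)"

definition reduced_expr :: "'n::{finite,linorder} list \<Rightarrow> ('n \<Rightarrow> 'n) \<Rightarrow> bool"
  where "reduced_expr Q w \<longleftrightarrow> word_prod Q = w \<and> length Q = cox_length w"

definition bruhat_step :: "('n::{finite,linorder} \<Rightarrow> 'n) \<Rightarrow> ('n \<Rightarrow> 'n) \<Rightarrow> bool"
  where "bruhat_step u v \<longleftrightarrow>
    (\<exists>\<beta>\<in>roots. v = root_refl \<beta> \<circ> u) \<and> cox_length u < cox_length v"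

definition bruhat_le :: "('n::{finite,linorder} \<Rightarrow> 'n) \<Rightarrow> ('n \<Rightarrow> 'n) \<Rightarrow> bool"
  (infix \<open>\<le>\<^sub>B\<close> 50)
  where "u \<le>\<^sub>B v \<longleftrightarrow> bruhat_step\<^sup>*\<^sup>* u v"

definition bruhat_cover :: "('n::{finite,linorder} \<Rightarrow> 'n) \<Rightarrow> ('n \<Rightarrow> 'n) \<Rightarrow> bool"
  (infix \<open>\<prec>\<^sub>B\<close> 50)
  where "u \<prec>\<^sub>B v \<longleftrightarrow>
    u \<le>\<^sub>B v \<and> u \<noteq> v \<and> (\<forall>x\<in>sym_group. u \<le>\<^sub>B x \<and> x \<le>\<^sub>B v \<longrightarrow> x = u \<or> x = v)"

text \<open>
  Positions in a word are counted from \<open>0\<close>, as in \<^const>\<open>nths\<close>: the set \<open>[m]\<close> becomes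
  \<open>{..<length Q}\<close> and the positions strictly before \<open>k\<close> are \<open>{..<k}\<close>.
\<close>

definition sc_facets :: "'n::{finite,linorder} list \<Rightarrow> ('n \<Rightarrow> 'n) \<Rightarrow> nat set set"
  where "sc_facets Q w =
    {J. J \<subseteq> {..<length Q} \<and> reduced_expr (nths Q ({..<length Q} - J)) w}"

definition subword_complex :: "'n::{finite,linorder} list \<Rightarrow> ('n \<Rightarrow> 'n) \<Rightarrow> nat set set"
  where "subword_complex Q w = {I. \<exists>J\<in>sc_facets Q w. I \<subseteq> J}"

definition root_fun :: "'n::{finite,linorder} list \<Rightarrow> nat set \<Rightarrow> nat \<Rightarrow> (real, 'n) vec"
  where "root_fun Q J k = act (word_prod (nths Q ({..<k} - J))) (simple_root (Q ! k))"

definition weight_fun :: "'n::{finite,linorder} list \<Rightarrow> nat set \<Rightarrow> nat \<Rightarrow> (real, 'n) vec"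
  where "weight_fun Q J k = act (word_prod (nths Q ({..<k} - J))) (fund_weight (Q ! k))"

definition Dem :: "'n::{finite,linorder} list \<Rightarrow> 'n \<Rightarrow> 'n"
  where "Dem Q =
    (let P = {word_prod (nths Q X) | X. X \<subseteq> {..<length Q}}
     in THE u. u \<in> P \<and> (\<forall>v\<in>P. v \<le>\<^sub>B u))"

definition brick_vector :: "'n::{finite,linorder} list \<Rightarrow> nat set \<Rightarrow> (real, 'n) vec"
  where "brick_vector Q J = - (\<Sum>k<length Q. weight_fun Q J k)"

text \<open>
  The cone spanned by a set of vectors is \<^term>\<open>convex_cone hull X\<close>, which is \<open>{0}\<close> for empty \<open>X\<close>.
  (The library's \<^term>\<open>cone hull X\<close> is not convex in general.)
\<close>

definition brick_polyhedron :: "'n::{finite,linorder} list \<Rightarrow> ('n \<Rightarrow> 'n) \<Rightarrow> ((real, 'n) vec) set"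
  where "brick_polyhedron Q w =
    convex hull (brick_vector Q ` sc_facets Q w) +
    convex_cone hull
      {\<beta> \<in> pos_roots. w \<prec>\<^sub>B root_refl \<beta> \<circ> w \<and> root_refl \<beta> \<circ> w \<le>\<^sub>B Dem Q}"

definition facets_above ::
    "'n::{finite,linorder} list \<Rightarrow> ('n \<Rightarrow> 'n) \<Rightarrow> nat set \<Rightarrow> nat set set"
  where "facets_above Q w I = {J \<in> sc_facets Q w. I \<subseteq> J}"

definition root_conf :: "'n::{finite,linorder} list \<Rightarrow> nat set \<Rightarrow> nat set \<Rightarrow> ((real, 'n) vec) set"
  where "root_conf Q I J = {root_fun Q J j | j. j \<in> J - I}"

definition root_cone ::
    "'n::{finite,linorder} list \<Rightarrow> ('n \<Rightarrow> 'n) \<Rightarrow> nat set \<Rightarrow> ((real, 'n) vec) set"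
  where "root_cone Q w I = (\<Inter>J\<in>facets_above Q w I. convex_cone hull (root_conf Q I J))"

definition modified_brick_polyhedron ::
    "'n::{finite,linorder} list \<Rightarrow> ('n \<Rightarrow> 'n) \<Rightarrow> nat set \<Rightarrow> ((real, 'n) vec) set"
  where "modified_brick_polyhedron Q w I =
    convex hull (brick_vector Q ` facets_above Q w I) + root_cone Q w I"

lemma act_e: "act w (std_basis i) = std_basis (w i)"
proof -
  have "act w (std_basis i) = (\<Sum>j\<in>UNIV. if j = i then std_basis (w j) else 0)"
    unfolding act_def by (rule sum.cong) (auto simp: std_basis_def axis_def)
  then show ?thesis by simp
qed

lemma act_inj: "act u = act v \<Longrightarrow> u = v"
  using act_e[of u] act_e[of v] by (auto simp: fun_eq_iff std_basis_def axis_eq_axis)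

lemma refl_map_e:
  assumes "i \<noteq> j"
  shows "refl_map (std_basis i - std_basis j) (std_basis k) = std_basis (Transposition.transpose i j k)"
  using assms
  by (auto simp: refl_map_def std_basis_def inner_diff_left inner_diff_right inner_axis_axis
        Transposition.transpose_def)

lemma linear_act: "linear (act w)"
  by (auto simp: act_def linear_iff scaleR_add_left sum.distrib scaleR_sum_right)

lemma linear_refl_map: "linear (refl_map \<beta>)"
  by (auto simp: refl_map_def linear_iff inner_simps algebra_simps add_divide_distrib)

lemma root_refl_eq:
  assumes "i \<noteq> j"
  shows "root_refl (std_basis i - std_basis j) = Transposition.transpose i j"
proof -
  have "act (Transposition.transpose i j) = refl_map (std_basis i - std_basis j)"
  proof (rule linear_eq_stdbasis[OF linear_act linear_refl_map])
    fix b :: "real ^ 'a" assume "b \<in> Basis"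
    then obtain k where "b = std_basis k"
      by (auto simp: Basis_vec_def std_basis_def)
    then show "act (Transposition.transpose i j) b = refl_map (std_basis i - std_basis j) b"
      using assms by (simp add: act_e refl_map_e)
  qed
  then show ?thesis
    unfolding root_refl_def
    by (intro the_equality) (auto simp: sym_group_def permutes_swap_id intro: act_inj)
qed

end

theory Submission
  imports Defs
begin

text \<open>
  Linear functionals decide everything. If \<open>f\<close> is bounded below on the brick polyhedron, the face on
  which it is minimal is determined by the facets \<open>J\<close> whose brick vector minimises \<open>f\<close>, and these
  turn out to be exactly the facets all of whose roots \<open>r(J, j)\<close>, \<open>j \<in> J\<close>, satisfy
  \<open>f \<bullet> r(J, j) \<ge> 0\<close> (\<open>weak_sink\<close>).

  One direction is local (\<open>weak_sink_if_brick_min\<close>): flipping \<open>j\<close> out of \<open>J\<close> moves the brick vector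
  by a positive multiple of \<open>r(J, j)\<close>, and if \<open>j\<close> cannot be flipped, then \<open>r(J, j)\<close> is one of the
  generators of the Bruhat cone.

  The other direction is global and rests on a uniqueness theorem (\<open>sink_unique\<close>): for a total order
  on the indices, at most one facet has only roots \<open>e\<^sub>a - e\<^sub>b\<close> with \<open>a\<close> before \<open>b\<close>. For the usual
  order such a facet can be read off from the word backwards; any other order is reached by
  exchanging neighbours, and each exchange moves the facet in a reversible way. Breaking ties of \<open>f\<close>
  yields a total order, a minimiser of \<open>f\<close> (with ties broken in the same way) is the unique facet for
  it, and hence every weak sink minimises \<open>f\<close> (\<open>weak_sink_weight_max\<close>). That a minimiser has no
  descending root is clear only if the corresponding positions can be flipped. So the word is first
  prolonged until its product is the longest permutation, for which every position can be flipped;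
  facets of the original word remain facets.

  Since the weights of a facet \<open>J\<close> are optimal one position at a time, the prolonged word also shows
  that \<open>f\<close> is non-negative on the Bruhat cone as soon as it is non-negative on the roots of a single
  facet (\<open>weak_sink_generator_nonneg\<close>): flip the position of a Bruhat root into the added part of the
  word, where the weights of all original facets coincide, and compare. Hence the brick polyhedron is
  the intersection of the cones spanned by the roots at its vertices (\<open>brick_polyhedron_eq_Inter\<close>).
  It is therefore a polyhedron, and its faces are exposed.

  For the face on which \<open>f\<close> is minimal, let \<open>J\<close> be a minimising facet and \<open>I\<close> the set of positions
  \<open>j \<in> J\<close> with \<open>f \<bullet> r(J, j) > 0\<close>. By uniqueness \<open>I\<close> does not depend on \<open>J\<close>, and on the facets
  containing \<open>I\<close> both \<open>f\<close> and \<open>-f\<close> are minimal everywhere, so that these facets are exactly the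
  minimising ones (\<open>facets_above_iff_brick_min\<close>). The part of the Bruhat cone on which \<open>f\<close>
  vanishes is the intersection of the cones of the remaining roots (\<open>root_cone_eq\<close>).
\<close>

section \<open>Inversions and the length of a permutation\<close>

abbreviation swp :: "'a \<Rightarrow> 'a \<Rightarrow> 'a \<Rightarrow> 'a"
  where "swp \<equiv> Transposition.transpose"

text \<open>
  Inversions are recorded as pairs of values, because left multiplication by a transposition exchanges
  values and the roots of a word are indexed by values.
\<close>

definition invs :: "('n::{finite,linorder} \<Rightarrow> 'n) \<Rightarrow> ('n \<times> 'n) set"
  where "invs w = {(a, b). a < b \<and> inv w b < inv w a}"

lemma mem_invs: "(a, b) \<in> invs w \<longleftrightarrow> a < b \<and> inv w b < inv w a"
  by (simp add: invs_def)

lemma next_index_gt: "p \<in> simple_indices \<Longrightarrow> p < next_index p"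
  using Min_in[of "{q. p < q}"] by (auto simp: simple_indices_def next_index_def)

lemma next_index_le: "p < q \<Longrightarrow> next_index p \<le> q"
  by (auto simp: next_index_def intro: Min_le)

text \<open>
  The indices \<open>p\<close> and \<open>next_index p\<close> are neighbours, so exchanging them disturbs no other comparison.
  This is the reason why a simple reflection changes the set of inversions by exactly one pair.
\<close>

lemma simple_refl_less_iff:
  assumes "p \<in> simple_indices" "{x, y} \<noteq> {p, next_index p}"
  shows "simple_refl p x < simple_refl p y \<longleftrightarrow> x < y"
proof -
  have "q \<le> p \<or> next_index p \<le> q" for q
    using next_index_le[of p q] by force
  from this[of x] this[of y] next_index_gt[OF assms(1)] assms(2) show ?thesis
    by (auto simp: simple_refl_def Transposition.transpose_def)
qed

lemma bij_simple_refl [simp]: "bij (simple_refl p)"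
  by (simp add: simple_refl_def)

lemma simple_refl_swap [simp]:
  "simple_refl p p = next_index p" "simple_refl p (next_index p) = p"
  by (simp_all add: simple_refl_def)

lemma bij_comp_simple_refl [simp]: "bij w \<Longrightarrow> bij (w \<circ> simple_refl p)"
  by (rule bij_comp) auto

lemma bij_swp_comp [simp]: "bij w \<Longrightarrow> bij (swp a b \<circ> w)"
  by (rule bij_comp) auto

lemma simple_refl_involutory [simp]:
  "simple_refl p (simple_refl p x) = x" "simple_refl p \<circ> simple_refl p = id"
  by (simp_all add: simple_refl_def)

lemma inv_comp_simple_refl: "bij w \<Longrightarrow> inv (w \<circ> simple_refl p) x = simple_refl p (inv w x)"
  by (simp add: o_inv_distrib simple_refl_def)

lemma inv_swp_comp: "bij w \<Longrightarrow> inv (swp a b \<circ> w) x = inv w (swp a b x)"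
  by (simp add: o_inv_distrib)

lemma inv_f: "bij w \<Longrightarrow> inv w (w x) = x"
  by (simp add: bij_is_inj)

lemma f_inv: "bij w \<Longrightarrow> w (inv w x) = x"
  by (simp add: bij_is_surj surj_f_inv_f)

lemma inv_eq_inv_iff: "bij w \<Longrightarrow> inv w x = inv w y \<longleftrightarrow> x = y"
  by (metis f_inv)

lemma finite_invs [simp]: "finite (invs (w :: 'n::{finite,linorder} \<Rightarrow> 'n))"
  by simp

lemma invs_swp_comp_iff:
  assumes "bij w" "a < b"
  shows "(a, b) \<in> invs (swp a b \<circ> w) \<longleftrightarrow> (a, b) \<notin> invs w"
  using assms inv_eq_inv_iff[OF assms(1), of a b] by (auto simp: mem_invs inv_swp_comp)

lemma invs_ascent:
  assumes "bij w" "p \<in> simple_indices" "w p < w (next_index p)"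
  shows "invs (w \<circ> simple_refl p) = insert (w p, w (next_index p)) (invs w)"
    and "(w p, w (next_index p)) \<notin> invs w"
proof -
  let ?n = "next_index p"
  have pn: "p < ?n" by (rule next_index_gt[OF assms(2)])
  show notin: "(w p, w ?n) \<notin> invs w"
    using pn by (simp add: mem_invs inv_f[OF assms(1)] not_less less_imp_le)
  have "(a, b) \<in> invs (w \<circ> simple_refl p) \<longleftrightarrow> (a, b) \<in> insert (w p, w ?n) (invs w)" for a b
  proof (cases "{inv w a, inv w b} = {p, ?n}")
    case True
    then have "inv w a = p \<and> inv w b = ?n \<or> inv w a = ?n \<and> inv w b = p"
      by (simp only: doubleton_eq_iff)
    then have "a = w p \<and> b = w ?n \<or> a = w ?n \<and> b = w p"
      using f_inv[OF assms(1), of a] f_inv[OF assms(1), of b] by auto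
    then show ?thesis
    proof (elim disjE conjE)
      assume "a = w p" "b = w ?n"
      then show ?thesis
        using pn assms(3)
        by (simp add: mem_invs inv_comp_simple_refl[OF assms(1)] inv_f[OF assms(1)])
    next
      assume "a = w ?n" "b = w p"
      then have "\<not> a < b" "(a, b) \<noteq> (w p, w ?n)" using assms(3) by auto
      then show ?thesis by (simp only: mem_invs insert_iff simp_thms)
    qed
  next
    case False
    then have "(a, b) \<noteq> (w p, w ?n)"
      using inv_f[OF assms(1), of p] inv_f[OF assms(1), of ?n] by (metis Pair_inject)
    moreover have "simple_refl p (inv w b) < simple_refl p (inv w a) \<longleftrightarrow> inv w b < inv w a"
      using False by (intro simple_refl_less_iff[OF assms(2)]) (simp add: insert_commute)
    ultimately show ?thesis
      by (simp add: mem_invs inv_comp_simple_refl[OF assms(1)]) blast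
  qed
  then show "invs (w \<circ> simple_refl p) = insert (w p, w ?n) (invs w)" by force
qed

lemma invs_descent:
  assumes "bij w" "p \<in> simple_indices" "w (next_index p) < w p"
  shows "invs w = insert (w (next_index p), w p) (invs (w \<circ> simple_refl p))"
    and "(w (next_index p), w p) \<notin> invs (w \<circ> simple_refl p)"
proof -
  have "(w \<circ> simple_refl p) \<circ> simple_refl p = w"
    by (simp only: comp_assoc simple_refl_involutory comp_id)
  then show "invs w = insert (w (next_index p), w p) (invs (w \<circ> simple_refl p))"
    "(w (next_index p), w p) \<notin> invs (w \<circ> simple_refl p)"
    using invs_ascent[of "w \<circ> simple_refl p" p] assms by auto
qed

lemma card_invs_ascent:
  assumes "bij w" "p \<in> simple_indices" "w p < w (next_index p)"
  shows "card (invs (w \<circ> simple_refl p)) = Suc (card (invs w))"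
  unfolding invs_ascent(1)[OF assms] by (rule card_insert_disjoint[OF finite_invs invs_ascent(2)[OF assms]])

lemma card_invs_descent:
  assumes "bij w" "p \<in> simple_indices" "w (next_index p) < w p"
  shows "card (invs w) = Suc (card (invs (w \<circ> simple_refl p)))"
  by (subst invs_descent(1)[OF assms], rule card_insert_disjoint[OF finite_invs invs_descent(2)[OF assms]])

lemma image_next_index_neq:
  assumes "bij w" "p \<in> simple_indices"
  shows "w p \<noteq> w (next_index p)"
  using next_index_gt[OF assms(2)] bij_is_inj[OF assms(1)] by (metis injD less_irrefl)

lemma strict_mono_if_next_less:
  fixes g :: "'n::{finite,linorder} \<Rightarrow> 'b::linorder"
  assumes "\<And>p. p \<in> simple_indices \<Longrightarrow> g p < g (next_index p)"
  shows "strict_mono g"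
proof (rule strict_monoI, rule ccontr)
  fix x y :: 'n
  assume xy: "x < y" "\<not> g x < g y"
  define y0 where "y0 = Min {y. x < y \<and> \<not> g x < g y}"
  have "y0 \<in> {y. x < y \<and> \<not> g x < g y}"
    unfolding y0_def
  proof (rule Min_in)
    show "{y. x < y \<and> \<not> g x < g y} \<noteq> {}" using xy by blast
  qed simp
  then have y0: "x < y0" "\<not> g x < g y0" by auto
  have below: "g x < g z" if "x < z" "z < y0" for z
  proof (rule ccontr)
    assume "\<not> g x < g z"
    with that have "y0 \<le> z" unfolding y0_def by (intro Min_le) auto
    with that show False by simp
  qed
  define z where "z = Max {z. z < y0}"
  have "z \<in> {z. z < y0}"
    unfolding z_def using y0(1) by (intro Max_in) auto
  moreover have "x \<le> z"
    unfolding z_def using y0(1) by (intro Max_ge) auto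
  ultimately have z: "z < y0" "x \<le> z" by auto
  have "next_index z \<le> y0" "z \<in> simple_indices"
    using next_index_le[OF z(1)] z(1) unfolding simple_indices_def by blast+
  moreover have "\<not> next_index z < y0"
  proof
    assume "next_index z < y0"
    then have "next_index z \<le> z" unfolding z_def by (intro Max_ge) auto
    with next_index_gt[OF \<open>z \<in> simple_indices\<close>] show False by simp
  qed
  ultimately have "next_index z = y0" by simp
  with assms[OF \<open>z \<in> simple_indices\<close>] have "g z < g y0" by simp
  moreover have "g x \<le> g z" using below[of z] z by (cases "x = z") (auto intro: less_imp_le)
  ultimately show False using y0(2) by auto
qed

lemma strict_mono_bij_eq_id:
  fixes w :: "'n::{finite,linorder} \<Rightarrow> 'n"
  assumes "strict_mono w" "bij w"
  shows "w = id"
proof (rule ccontr)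
  assume "w \<noteq> id"
  define x where "x = Min {x. w x \<noteq> x}"
  have "x \<in> {x. w x \<noteq> x}"
    unfolding x_def using \<open>w \<noteq> id\<close> by (intro Min_in) (auto simp: fun_eq_iff)
  then have x: "w x \<noteq> x" by simp
  have below: "w z = z" if "z < x" for z
  proof (rule ccontr)
    assume "w z \<noteq> z"
    then have "x \<le> z" by (simp add: x_def)
    with that show False by simp
  qed
  obtain y where y: "x = w y" using assms(2) by (metis bij_pointE)
  have "y \<noteq> x" using x y by auto
  moreover have "\<not> y < x" using below[of y] y \<open>y \<noteq> x\<close> by auto
  ultimately have "x < y" by (simp add: not_less le_less)
  then have "w x < x" using strict_monoD[OF assms(1)] y by metis
  then have "w (w x) = w x" using below by simp
  then show False using x assms(2) by (metis inv_f)
qed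

lemma eq_id_if_no_descent:
  assumes "bij w" "\<And>p. p \<in> simple_indices \<Longrightarrow> \<not> w (next_index p) < w p"
  shows "w = id"
proof (rule strict_mono_bij_eq_id[OF strict_mono_if_next_less assms(1)])
  fix p :: 'a assume "p \<in> simple_indices"
  then show "w p < w (next_index p)"
    using assms(2)[of p] image_next_index_neq[OF assms(1), of p] by (auto simp: not_less le_less)
qed

lemma invs_id [simp]: "invs id = {}"
  unfolding invs_def inv_id id_apply by auto

lemma word_prod_Nil [simp]: "word_prod [] = id"
  by (simp add: word_prod_def)

lemma word_prod_Cons [simp]: "word_prod (p # Q) = simple_refl p \<circ> word_prod Q"
  by (simp add: word_prod_def)

lemma word_prod_append [simp]: "word_prod (Q @ R) = word_prod Q \<circ> word_prod R"
  by (induction Q) (simp_all only: comp_assoc word_prod_Cons append.simps word_prod_Nil id_comp)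

lemma bij_word_prod [simp]: "bij (word_prod Q)"
proof (induction Q)
  case Nil
  show ?case unfolding word_prod_Nil by (rule bij_id)
next
  case (Cons p Q)
  then show ?case unfolding word_prod_Cons by (intro bij_comp) auto
qed

text \<open>
  Bubble sort: as long as there is an inversion, there is a descent, and removing it removes exactly one
  inversion.
\<close>

lemma ex_word_of_card_invs:
  assumes "bij w"
  obtains Q where "set Q \<subseteq> simple_indices" "length Q = card (invs w)" "word_prod Q = w"
proof -
  have "\<exists>Q. set Q \<subseteq> simple_indices \<and> length Q = k \<and> word_prod Q = w"
    if "bij w" "card (invs w) = k" for k and w :: "'a \<Rightarrow> 'a"
    using that
  proof (induction k arbitrary: w)
    case 0
    then have "invs w = {}" by simp
    have "w = id"
    proof (rule eq_id_if_no_descent[OF "0.prems"(1)], rule notI)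
      fix p :: 'a assume p: "p \<in> simple_indices" "w (next_index p) < w p"
      from invs_descent(1)[OF "0.prems"(1) p] \<open>invs w = {}\<close> show False by simp
    qed
    show ?case
    proof (intro exI[of _ "[]"] conjI)
      show "word_prod [] = w" unfolding \<open>w = id\<close> by (rule word_prod_Nil)
    qed simp_all
  next
    case (Suc k)
    have "w \<noteq> id"
    proof
      assume "w = id"
      from Suc.prems(2) show False unfolding \<open>w = id\<close> invs_id card.empty by simp
    qed
    have "\<exists>p\<in>simple_indices. w (next_index p) < w p"
    proof (rule ccontr)
      assume "\<not> ?thesis"
      then have "w = id" by (intro eq_id_if_no_descent[OF Suc.prems(1)]) blast
      with \<open>w \<noteq> id\<close> show False by contradiction
    qed
    then obtain p where p: "p \<in> simple_indices" "w (next_index p) < w p" by (rule bexE)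
    have "card (invs (w \<circ> simple_refl p)) = k"
      using card_invs_descent[OF Suc.prems(1) p] unfolding Suc.prems(2) by simp
    from Suc.IH[OF bij_comp_simple_refl[OF Suc.prems(1)] this]
    obtain Q where Q: "set Q \<subseteq> simple_indices" "length Q = k" "word_prod Q = w \<circ> simple_refl p"
      by (elim exE conjE)
    show ?case
    proof (intro exI[of _ "Q @ [p]"] conjI)
      show "word_prod (Q @ [p]) = w"
        unfolding word_prod_append word_prod_Cons word_prod_Nil Q(3)
        by (simp only: comp_assoc simple_refl_involutory comp_id)
    qed (use Q(1,2) p(1) in simp_all)
  qed
  from this[OF assms refl] show ?thesis using that by blast
qed

lemma card_invs_comp_simple_refl_le:
  assumes "bij w" "p \<in> simple_indices"
  shows "card (invs (w \<circ> simple_refl p)) \<le> Suc (card (invs w))"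
  using image_next_index_neq[OF assms]
proof (rule linorder_neqE)
  assume "w p < w (next_index p)"
  from card_invs_ascent[OF assms this] show ?thesis by (rule eq_imp_le)
next
  assume "w (next_index p) < w p"
  from card_invs_descent[OF assms this] show ?thesis by linarith
qed

lemma card_invs_word_prod_le:
  assumes "set Q \<subseteq> simple_indices"
  shows "card (invs (word_prod Q)) \<le> length Q"
  using assms
proof (induction Q rule: rev_induct)
  case Nil
  show ?case unfolding word_prod_Nil invs_id card.empty by (rule le0)
next
  case (snoc p Q)
  have "p \<in> simple_indices" "set Q \<subseteq> simple_indices" using snoc.prems by simp_all
  then have "card (invs (word_prod Q)) \<le> length Q" by (intro snoc.IH)
  with card_invs_comp_simple_refl_le[OF bij_word_prod \<open>p \<in> simple_indices\<close>, of Q]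
  have "card (invs (word_prod Q \<circ> simple_refl p)) \<le> length (Q @ [p])"
    unfolding length_append_singleton by linarith
  then show ?case unfolding word_prod_append word_prod_Cons word_prod_Nil comp_id .
qed

lemma cox_length_eq_card_invs:
  assumes "bij w"
  shows "cox_length w = card (invs w)"
  unfolding cox_length_def
proof (rule Least_equality)
  obtain Q where "set Q \<subseteq> simple_indices" "length Q = card (invs w)" "word_prod Q = w"
    using assms by (rule ex_word_of_card_invs)
  then show "\<exists>Q. set Q \<subseteq> simple_indices \<and> length Q = card (invs w) \<and> word_prod Q = w" by blast
  fix k assume "\<exists>Q. set Q \<subseteq> simple_indices \<and> length Q = k \<and> word_prod Q = w"
  then obtain Q where "set Q \<subseteq> simple_indices" "length Q = k" "word_prod Q = w" by (elim exE conjE)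
  with card_invs_word_prod_le[of Q] show "card (invs w) \<le> k" by blast
qed

lemma sym_group_iff: "w \<in> sym_group \<longleftrightarrow> bij w"
  unfolding sym_group_def mem_Collect_eq
proof
  show "w permutes UNIV \<Longrightarrow> bij w" by (rule permutes_bij)
  show "bij w \<Longrightarrow> w permutes UNIV" by (rule bij_imp_permutes) simp_all
qed

section \<open>Prefix permutations, roots and flips\<close>

definition prefix_prod :: "'n::{finite,linorder} list \<Rightarrow> nat set \<Rightarrow> nat \<Rightarrow> 'n \<Rightarrow> 'n"
  where "prefix_prod Q J k = word_prod (nths Q ({..<k} - J))"

definition root_src :: "'n::{finite,linorder} list \<Rightarrow> nat set \<Rightarrow> nat \<Rightarrow> 'n"
  where "root_src Q J k = prefix_prod Q J k (Q ! k)"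

definition root_tgt :: "'n::{finite,linorder} list \<Rightarrow> nat set \<Rightarrow> nat \<Rightarrow> 'n"
  where "root_tgt Q J k = prefix_prod Q J k (next_index (Q ! k))"

lemma nths_cong_indices:
  assumes "\<And>i. i < length xs \<Longrightarrow> i \<in> A \<longleftrightarrow> i \<in> B"
  shows "nths xs A = nths xs B"
  unfolding nths_def
  by (intro arg_cong[where f = "map fst"] filter_cong) (auto simp: assms set_zip)

lemma nths_lessThan_Suc_diff:
  assumes "k < length Q"
  shows "nths Q ({..<Suc k} - J) = nths Q ({..<k} - J) @ (if k \<in> J then [] else [Q ! k])"
proof -
  have Q: "Q = take k Q @ Q ! k # drop (Suc k) Q"
    using assms by (rule id_take_nth_drop)
  have len: "length (take k Q) = k" using assms by simp
  have 1: "nths (take k Q) ({..<Suc k} - J) = nths (take k Q) ({..<k} - J)"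
    by (rule nths_cong_indices) (use assms in auto)
  have 2: "{j. j + k \<in> {..<k} - J} = {}" "{j. Suc j + k \<in> {..<Suc k} - J} = {}" by auto
  have "nths Q ({..<Suc k} - J) = nths (take k Q) ({..<k} - J) @ (if k \<in> J then [] else [Q ! k])"
    by (subst Q, subst nths_append) (simp only: len 1 nths_Cons mem_Collect_eq 2 nths_empty, simp)
  moreover have "nths Q ({..<k} - J) = nths (take k Q) ({..<k} - J)"
    by (subst Q, subst nths_append) (simp only: len 2 nths_empty, simp)
  ultimately show ?thesis by simp
qed

lemma bij_prefix_prod [simp]: "bij (prefix_prod Q J k)"
  by (simp add: prefix_prod_def)

lemma prefix_prod_0: "prefix_prod Q J 0 = id"
  unfolding prefix_prod_def by (simp only: lessThan_0 empty_Diff nths_empty word_prod_Nil)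

lemma prefix_prod_Suc_mem: "k < length Q \<Longrightarrow> k \<in> J \<Longrightarrow> prefix_prod Q J (Suc k) = prefix_prod Q J k"
  by (simp add: prefix_prod_def nths_lessThan_Suc_diff)

lemma prefix_prod_Suc_notin:
  "k < length Q \<Longrightarrow> k \<notin> J \<Longrightarrow> prefix_prod Q J (Suc k) = prefix_prod Q J k \<circ> simple_refl (Q ! k)"
  unfolding prefix_prod_def
  by (simp only: nths_lessThan_Suc_diff if_False word_prod_append word_prod_Cons word_prod_Nil comp_id)

lemma prefix_prod_cong:
  assumes "\<And>i. i < k \<Longrightarrow> i \<in> J \<longleftrightarrow> i \<in> K"
  shows "prefix_prod Q J k = prefix_prod Q K k"
proof -
  have "{..<k} - J = {..<k} - K" using assms by auto
  then show ?thesis by (simp add: prefix_prod_def)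
qed

lemma simple_comp_eq_swp_comp:
  assumes "bij w"
  shows "w \<circ> simple_refl p = swp (w p) (w (next_index p)) \<circ> w"
  unfolding transpose_comp_eq[OF assms] simple_refl_def inv_f[OF assms] ..

lemma prefix_prod_Suc_notin':
  "k < length Q \<Longrightarrow> k \<notin> J \<Longrightarrow>
    prefix_prod Q J (Suc k) = swp (root_src Q J k) (root_tgt Q J k) \<circ> prefix_prod Q J k"
  unfolding root_src_def root_tgt_def
  using prefix_prod_Suc_notin[of k Q J] simple_comp_eq_swp_comp[OF bij_prefix_prod, of Q J k "Q ! k"] by (rule trans)

lemma letter_simple: "set Q \<subseteq> simple_indices \<Longrightarrow> k < length Q \<Longrightarrow> Q ! k \<in> simple_indices"
  by auto

lemma root_src_neq_tgt:
  "set Q \<subseteq> simple_indices \<Longrightarrow> k < length Q \<Longrightarrow> root_src Q J k \<noteq> root_tgt Q J k"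
  unfolding root_src_def root_tgt_def by (intro image_next_index_neq bij_prefix_prod letter_simple)

lemma inv_prefix_prod_root_src: "inv (prefix_prod Q J k) (root_src Q J k) = Q ! k"
  unfolding root_src_def by (intro inv_f bij_prefix_prod)

lemma inv_prefix_prod_root_tgt: "inv (prefix_prod Q J k) (root_tgt Q J k) = next_index (Q ! k)"
  unfolding root_tgt_def by (intro inv_f bij_prefix_prod)

text \<open>
  A position that leaves \<open>J\<close> contributes its reflection, which can be moved to the front of every later
  prefix, where it acts as the transposition of the two values of the root.
\<close>

lemma prefix_prod_remove:
  assumes "i \<in> J" "i < length Q" "k \<le> length Q"
  shows "prefix_prod Q (J - {i}) k =
    (if k \<le> i then prefix_prod Q J k else swp (root_src Q J i) (root_tgt Q J i) \<circ> prefix_prod Q J k)"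
  using assms(3)
proof (induction k)
  case 0
  show ?case by (simp add: prefix_prod_0)
next
  case (Suc k)
  then have k: "k < length Q" and le: "k \<le> length Q" by simp_all
  note IH = Suc.IH[OF le]
  consider "k < i" | "k = i" | "i < k" by linarith
  then show ?case
  proof cases
    case 1
    then show ?thesis
      using IH k by (cases "k \<in> J") (simp_all add: prefix_prod_Suc_mem prefix_prod_Suc_notin)
  next
    case 2
    have "prefix_prod Q (J - {i}) i = prefix_prod Q J i" using IH 2 by simp
    then have src: "root_src Q (J - {i}) i = root_src Q J i" "root_tgt Q (J - {i}) i = root_tgt Q J i"
      by (simp_all add: root_src_def root_tgt_def)
    have "prefix_prod Q (J - {i}) (Suc i) = swp (root_src Q J i) (root_tgt Q J i) \<circ> prefix_prod Q J i"
      using prefix_prod_Suc_notin'[OF assms(2), of "J - {i}"] src \<open>prefix_prod Q (J - {i}) i = prefix_prod Q J i\<close> by simp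
    then show ?thesis using 2 prefix_prod_Suc_mem[OF assms(2,1)] by simp
  next
    case 3
    then show ?thesis
      using IH k by (cases "k \<in> J") (simp_all add: prefix_prod_Suc_mem prefix_prod_Suc_notin comp_assoc)
  qed
qed

lemma prefix_prod_insert:
  assumes "i \<notin> J" "i < length Q" "k \<le> length Q"
  shows "prefix_prod Q (insert i J) k =
    (if k \<le> i then prefix_prod Q J k else swp (root_src Q J i) (root_tgt Q J i) \<circ> prefix_prod Q J k)"
proof -
  have eq: "insert i J - {i} = J" using assms(1) by auto
  have "prefix_prod Q (insert i J) i = prefix_prod Q J i" by (rule prefix_prod_cong) simp
  then have "root_src Q (insert i J) i = root_src Q J i" "root_tgt Q (insert i J) i = root_tgt Q J i"
    by (simp_all add: root_src_def root_tgt_def)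
  with prefix_prod_remove[of i "insert i J" Q k] assms show ?thesis
    by (simp add: eq flip: comp_assoc)
qed

lemma swp_eq_if_doubleton_eq: "{a, b} = {c, d} \<Longrightarrow> swp a b = swp c d"
  by (auto simp: doubleton_eq_iff transpose_commute)

text \<open>
  When two positions with the same unordered root exchange their roles, the two reflections cancel
  except on the positions that lie after the first and not after the second one.
\<close>

definition swept :: "nat \<Rightarrow> nat \<Rightarrow> nat \<Rightarrow> bool"
  where "swept i j k \<longleftrightarrow> min i j < k \<and> k \<le> max i j"

text \<open>
  Two positions with the same unordered root carry the same reflection, so removing one and inserting
  the other cancels outside of the positions between them.
\<close>

lemma prefix_prod_exchange:
  assumes ij: "i \<in> J" "j \<notin> J" "i < length Q" "j < length Q"
    and k: "k \<le> length Q"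
    and pair: "{root_src Q J j, root_tgt Q J j} = {root_src Q J i, root_tgt Q J i}"
  shows "prefix_prod Q (insert j (J - {i})) k =
    (if swept i j k then swp (root_src Q J i) (root_tgt Q J i) \<circ> prefix_prod Q J k else prefix_prod Q J k)"
proof -
  let ?t = "swp (root_src Q J i) (root_tgt Q J i)"
  let ?J = "J - {i}"
  have tt: "?t \<circ> (?t \<circ> f) = f" for f :: "'a \<Rightarrow> 'a"
    by (simp flip: comp_assoc)
  have rem: "prefix_prod Q ?J l = (if l \<le> i then prefix_prod Q J l else ?t \<circ> prefix_prod Q J l)" if "l \<le> length Q" for l
    using prefix_prod_remove[OF ij(1,3) that] .
  have "prefix_prod Q ?J j = (if j \<le> i then prefix_prod Q J j else ?t \<circ> prefix_prod Q J j)"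
    using ij(4) by (intro rem) simp
  then have "root_src Q ?J j = (if j \<le> i then root_src Q J j else ?t (root_src Q J j))"
    "root_tgt Q ?J j = (if j \<le> i then root_tgt Q J j else ?t (root_tgt Q J j))"
    by (simp_all add: root_src_def root_tgt_def)
  then have "{root_src Q ?J j, root_tgt Q ?J j} = {root_src Q J i, root_tgt Q J i}"
    using pair by (auto simp: doubleton_eq_iff)
  then have sw: "swp (root_src Q ?J j) (root_tgt Q ?J j) = ?t"
    by (rule swp_eq_if_doubleton_eq)
  have "j \<notin> ?J" using ij by simp
  have ins: "prefix_prod Q (insert j ?J) k = (if k \<le> j then prefix_prod Q ?J k else ?t \<circ> prefix_prod Q ?J k)"
    using prefix_prod_insert[OF \<open>j \<notin> ?J\<close> ij(4) k] unfolding sw .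
  have "i \<noteq> j" using ij by auto
  then consider "swept i j k" "i < k" "k \<le> j" | "swept i j k" "j < k" "k \<le> i"
    | "\<not> swept i j k" "k \<le> i" "k \<le> j" | "\<not> swept i j k" "i < k" "j < k"
    unfolding swept_def by linarith
  then show ?thesis
    using ins rem[OF k] by cases (simp_all only: if_True if_False tt not_le[symmetric] simp_thms)
qed

section \<open>Facets as sequences of positive roots\<close>

text \<open>
  Each letter that is used adds or removes one inversion, according to the sign of its root. So a
  subword is reduced if and only if the roots of its letters are positive.
\<close>

lemma card_invs_prefix_prod:
  assumes "set Q \<subseteq> simple_indices" "k \<le> length Q"
  shows "card (invs (prefix_prod Q J k)) \<le> card ({..<k} - J)"
    and "card (invs (prefix_prod Q J k)) = card ({..<k} - J) \<longleftrightarrow>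
      (\<forall>i<k. i \<notin> J \<longrightarrow> root_src Q J i < root_tgt Q J i)"
proof -
  have "card (invs (prefix_prod Q J k)) \<le> card ({..<k} - J) \<and>
    (card (invs (prefix_prod Q J k)) = card ({..<k} - J) \<longleftrightarrow>
      (\<forall>i<k. i \<notin> J \<longrightarrow> root_src Q J i < root_tgt Q J i))"
    using assms(2)
  proof (induction k)
    case 0
    show ?case unfolding prefix_prod_0 invs_id by simp
  next
    case (Suc k)
    then have k: "k < length Q" by simp
    have all: "(\<forall>i<Suc k. P i) \<longleftrightarrow> P k \<and> (\<forall>i<k. P i)" for P by (auto simp: less_Suc_eq)
    show ?case
    proof (cases "k \<in> J")
      case True
      then have "{..<Suc k} - J = {..<k} - J" by (auto simp: less_Suc_eq)
      then show ?thesis using Suc True k by (simp add: prefix_prod_Suc_mem all)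
    next
      case False
      then have "{..<Suc k} - J = insert k ({..<k} - J)" by auto
      then have card: "card ({..<Suc k} - J) = Suc (card ({..<k} - J))" by simp
      note p = bij_prefix_prod letter_simple[OF assms(1) k]
      show ?thesis
        using image_next_index_neq[OF p, of Q J k]
      proof (rule linorder_neqE)
        assume *: "prefix_prod Q J k (Q ! k) < prefix_prod Q J k (next_index (Q ! k))"
        have c: "card (invs (prefix_prod Q J (Suc k))) = Suc (card (invs (prefix_prod Q J k)))"
          unfolding prefix_prod_Suc_notin[OF k False] by (rule card_invs_ascent[OF p *])
        show ?thesis
          unfolding all card c using Suc False k * by (simp add: root_src_def root_tgt_def)
      next
        assume *: "prefix_prod Q J k (next_index (Q ! k)) < prefix_prod Q J k (Q ! k)"
        have c: "card (invs (prefix_prod Q J k)) = Suc (card (invs (prefix_prod Q J (Suc k))))"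
          unfolding prefix_prod_Suc_notin[OF k False] by (rule card_invs_descent[OF p *])
        have "\<not> root_src Q J k < root_tgt Q J k"
          using * by (simp add: root_src_def root_tgt_def)
        then show ?thesis
          unfolding all card using Suc False k c by simp
      qed
    qed
  qed
  then show "card (invs (prefix_prod Q J k)) \<le> card ({..<k} - J)"
    and "card (invs (prefix_prod Q J k)) = card ({..<k} - J) \<longleftrightarrow>
      (\<forall>i<k. i \<notin> J \<longrightarrow> root_src Q J i < root_tgt Q J i)" by simp_all
qed

lemma sc_facets_iff_card:
  assumes "set Q \<subseteq> simple_indices"
  shows "J \<in> sc_facets Q w \<longleftrightarrow>
    J \<subseteq> {..<length Q} \<and> prefix_prod Q J (length Q) = w \<and> card ({..<length Q} - J) = card (invs w)"
proof -
  have "{i. i < length Q \<and> i \<in> {..<length Q} - J} = {..<length Q} - J" by auto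
  then have "length (nths Q ({..<length Q} - J)) = card ({..<length Q} - J)"
    unfolding length_nths by simp
  then show ?thesis
    unfolding sc_facets_def reduced_expr_def
    by (auto simp: prefix_prod_def[symmetric] cox_length_eq_card_invs)
qed

lemma sc_facets_iff:
  assumes "set Q \<subseteq> simple_indices"
  shows "J \<in> sc_facets Q w \<longleftrightarrow>
    J \<subseteq> {..<length Q} \<and> prefix_prod Q J (length Q) = w \<and>
    (\<forall>i<length Q. i \<notin> J \<longrightarrow> root_src Q J i < root_tgt Q J i)"
  unfolding sc_facets_iff_card[OF assms]
  using card_invs_prefix_prod(2)[OF assms order_refl, of J] by auto

text \<open>
  When all roots of the used letters are positive, every used letter creates the inversion given by its
  root and none is ever destroyed.
\<close>

lemma mem_invs_prefix_prod:
  assumes "set Q \<subseteq> simple_indices" "k \<le> length Q"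
    and pos: "\<And>i. i < k \<Longrightarrow> i \<notin> J \<Longrightarrow> root_src Q J i < root_tgt Q J i"
  shows "ab \<in> invs (prefix_prod Q J k) \<longleftrightarrow> (\<exists>i<k. i \<notin> J \<and> ab = (root_src Q J i, root_tgt Q J i))"
  using assms(2) pos
proof (induction k)
  case 0
  show ?case unfolding prefix_prod_0 invs_id by simp
next
  case (Suc k)
  then have k: "k < length Q" by simp
  have IH: "ab \<in> invs (prefix_prod Q J k) \<longleftrightarrow> (\<exists>i<k. i \<notin> J \<and> ab = (root_src Q J i, root_tgt Q J i))"
    using Suc by simp
  show ?case
  proof (cases "k \<in> J")
    case True
    then show ?thesis using IH k by (auto simp: prefix_prod_Suc_mem less_Suc_eq)
  next
    case False
    have "invs (prefix_prod Q J (Suc k)) = insert (root_src Q J k, root_tgt Q J k) (invs (prefix_prod Q J k))"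
      unfolding prefix_prod_Suc_notin[OF k False] root_src_def root_tgt_def
      using Suc.prems(2)[of k] False
      by (intro invs_ascent(1) bij_prefix_prod letter_simple[OF assms(1) k]) (simp add: root_src_def root_tgt_def)
    then show ?thesis using IH False by (auto simp: less_Suc_eq)
  qed
qed

lemma root_notin_invs_prefix_prod:
  assumes "set Q \<subseteq> simple_indices" "k < length Q"
  shows "(root_src Q J k, root_tgt Q J k) \<notin> invs (prefix_prod Q J k)"
  unfolding mem_invs inv_prefix_prod_root_src inv_prefix_prod_root_tgt
  using next_index_gt[OF letter_simple[OF assms]] by (simp add: not_less less_imp_le)

lemma root_reversed_in_invs_prefix_prod:
  assumes "set Q \<subseteq> simple_indices" "k < length Q" "root_tgt Q J k < root_src Q J k"
  shows "(root_tgt Q J k, root_src Q J k) \<in> invs (prefix_prod Q J k)"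
  unfolding mem_invs inv_prefix_prod_root_src inv_prefix_prod_root_tgt
  using next_index_gt[OF letter_simple[OF assms(1,2)]] assms(3) by simp

lemma root_fun_eq: "root_fun Q J k = std_basis (root_src Q J k) - std_basis (root_tgt Q J k)"
  unfolding root_fun_def simple_root_def linear_diff[OF linear_act] act_e
  by (simp only: prefix_prod_def root_src_def root_tgt_def)

lemma inner_std_basis [simp]: "f \<bullet> std_basis a = f $ a"
  by (simp add: std_basis_def inner_axis)

lemma std_basis_nth: "std_basis a $ x = of_bool (x = a)"
  by (simp add: std_basis_def axis_def)

lemma inner_root_fun: "f \<bullet> root_fun Q J k = f $ root_src Q J k - f $ root_tgt Q J k"
  by (simp add: root_fun_eq inner_diff_right)

lemma weight_fun_nth: "weight_fun Q J k $ x = of_bool (inv (prefix_prod Q J k) x \<le> Q ! k)"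
proof -
  have "weight_fun Q J k = (\<Sum>q\<in>{..Q ! k}. std_basis (prefix_prod Q J k q))"
    unfolding weight_fun_def fund_weight_def linear_sum[OF linear_act] act_e prefix_prod_def ..
  then have "weight_fun Q J k $ x = (\<Sum>q\<in>{..Q ! k}. of_bool (x = prefix_prod Q J k q))"
    by (simp add: std_basis_nth)
  also have "\<dots> = (\<Sum>q\<in>{..Q ! k}. if q = inv (prefix_prod Q J k) x then 1 else 0)"
    by (intro sum.cong refl) (auto simp: inv_f f_inv)
  also have "\<dots> = of_bool (inv (prefix_prod Q J k) x \<le> Q ! k)" by simp
  finally show ?thesis .
qed

text \<open>
  A reflection changes the indicator vector of a set of indices by a multiple of its root. The
  coefficient is \<open>1\<close>, \<open>0\<close> or \<open>-1\<close> according to which of the two indices belong to the set.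
\<close>

lemma weight_fun_swp:
  assumes "prefix_prod Q K k = swp a b \<circ> prefix_prod Q J k" "a \<noteq> b"
  shows "weight_fun Q K k = weight_fun Q J k -
    (of_bool (inv (prefix_prod Q J k) a \<le> Q ! k) - of_bool (inv (prefix_prod Q J k) b \<le> Q ! k)) *\<^sub>R
      (std_basis a - std_basis b)"
  unfolding vec_eq_iff
proof
  fix x
  have "weight_fun Q K k $ x = of_bool (inv (prefix_prod Q J k) (swp a b x) \<le> Q ! k)"
    by (simp add: weight_fun_nth assms(1) inv_swp_comp)
  then show "weight_fun Q K k $ x = (weight_fun Q J k -
    (of_bool (inv (prefix_prod Q J k) a \<le> Q ! k) - of_bool (inv (prefix_prod Q J k) b \<le> Q ! k)) *\<^sub>R
      (std_basis a - std_basis b)) $ x"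
    using assms(2)
    by (cases "x = a"; cases "x = b") (simp_all add: weight_fun_nth std_basis_nth)
qed

context
  fixes Q :: "'n::{finite,linorder} list" and w :: "'n \<Rightarrow> 'n" and J :: "nat set"
  assumes Q: "set Q \<subseteq> simple_indices" and J: "J \<in> sc_facets Q w"
begin

lemma facet_subset: "J \<subseteq> {..<length Q}"
  and facet_prefix_prod_length: "prefix_prod Q J (length Q) = w"
  and facet_root_pos: "i < length Q \<Longrightarrow> i \<notin> J \<Longrightarrow> root_src Q J i < root_tgt Q J i"
  using J unfolding sc_facets_iff[OF Q] by blast+

lemma facet_mem_invs_prefix_prod:
  "k \<le> length Q \<Longrightarrow>
    ab \<in> invs (prefix_prod Q J k) \<longleftrightarrow> (\<exists>i<k. i \<notin> J \<and> ab = (root_src Q J i, root_tgt Q J i))"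
  using facet_root_pos by (intro mem_invs_prefix_prod[OF Q]) auto

lemma facet_mem_invs:
  "ab \<in> invs w \<longleftrightarrow> (\<exists>i<length Q. i \<notin> J \<and> ab = (root_src Q J i, root_tgt Q J i))"
  using facet_mem_invs_prefix_prod[OF order_refl] unfolding facet_prefix_prod_length .

lemma facet_invs_prefix_prod_subset: "k \<le> length Q \<Longrightarrow> invs (prefix_prod Q J k) \<subseteq> invs w"
  using facet_mem_invs_prefix_prod facet_mem_invs by fastforce

text \<open>
  The root of a used letter is inverted exactly from that letter on; in particular no two used letters
  have the same root.
\<close>

lemma facet_root_in_invs_prefix_prod_iff:
  assumes j: "j < length Q" "j \<notin> J" and k: "k \<le> length Q"
  shows "(root_src Q J j, root_tgt Q J j) \<in> invs (prefix_prod Q J k) \<longleftrightarrow> j < k"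
proof
  assume "(root_src Q J j, root_tgt Q J j) \<in> invs (prefix_prod Q J k)"
  then obtain i where i: "i < k" "i \<notin> J" "(root_src Q J j, root_tgt Q J j) = (root_src Q J i, root_tgt Q J i)"
    using facet_mem_invs_prefix_prod[OF k] by blast
  have "\<not> i < j"
    using root_notin_invs_prefix_prod[OF Q j(1)] facet_mem_invs_prefix_prod[of j] i j(1) by (metis less_imp_le_nat)
  then show "j < k" using i(1) by simp
next
  assume "j < k"
  then show "(root_src Q J j, root_tgt Q J j) \<in> invs (prefix_prod Q J k)"
    using facet_mem_invs_prefix_prod[OF k] j(2) by blast
qed

text \<open>
  The order in which the two indices of a root occur changes only at the position \<open>j\<close> that inverts them,
  and \<open>j\<close> does not separate \<open>i\<close> from the positions swept. Hence the coefficients of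
  \<open>facet_exchange_weight\<close> all have the same sign.
\<close>

lemma facet_root_order_swept:
  assumes j: "j < length Q" "j \<notin> J" and i: "i < length Q" and k: "k < length Q" "swept i j k"
    and pair: "{root_src Q J j, root_tgt Q J j} = {root_src Q J i, root_tgt Q J i}"
  shows "inv (prefix_prod Q J k) (root_src Q J i) < inv (prefix_prod Q J k) (root_tgt Q J i)"
proof -
  let ?a = "root_src Q J j" and ?b = "root_tgt Q J j"
  have lt: "?a < ?b" by (rule facet_root_pos[OF j])
  have "(?a, ?b) \<in> invs (prefix_prod Q J k) \<longleftrightarrow> (?a, ?b) \<in> invs (prefix_prod Q J i)"
    using facet_root_in_invs_prefix_prod_iff[OF j, of k] facet_root_in_invs_prefix_prod_iff[OF j, of i] i k
    unfolding swept_def by auto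
  then have iff: "inv (prefix_prod Q J k) ?b < inv (prefix_prod Q J k) ?a \<longleftrightarrow> inv (prefix_prod Q J i) ?b < inv (prefix_prod Q J i) ?a"
    using lt by (simp add: mem_invs)
  have ne: "inv (prefix_prod Q J l) ?a \<noteq> inv (prefix_prod Q J l) ?b" for l
    using lt inv_eq_inv_iff[OF bij_prefix_prod, of Q J l ?a ?b] by auto
  have "inv (prefix_prod Q J i) (root_src Q J i) < inv (prefix_prod Q J i) (root_tgt Q J i)"
    unfolding inv_prefix_prod_root_src inv_prefix_prod_root_tgt by (rule next_index_gt[OF letter_simple[OF Q i]])
  moreover have "root_src Q J i = ?a \<and> root_tgt Q J i = ?b \<or> root_src Q J i = ?b \<and> root_tgt Q J i = ?a"
    using pair unfolding doubleton_eq_iff by metis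
  ultimately show ?thesis
    using iff ne[of k] by (metis linorder_neqE less_asym)
qed

lemma facet_exchange:
  assumes j: "j < length Q" "j \<notin> J" and i: "i \<in> J"
    and pair: "{root_src Q J j, root_tgt Q J j} = {root_src Q J i, root_tgt Q J i}"
  shows "insert j (J - {i}) \<in> sc_facets Q w"
  unfolding sc_facets_iff_card[OF Q]
proof (intro conjI)
  let ?m = "length Q" and ?K = "insert j (J - {i})"
  have im: "i < ?m" using i facet_subset by auto
  show "?K \<subseteq> {..<?m}" using j facet_subset by auto
  have "\<not> swept i j ?m" using im j(1) unfolding swept_def by linarith
  then show "prefix_prod Q ?K ?m = w"
    using prefix_prod_exchange[OF i j(2) im j(1) order_refl pair] facet_prefix_prod_length by simp
  have "{..<?m} - ?K = insert i ({..<?m} - J - {j})" using i j im by auto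
  moreover have "i \<notin> {..<?m} - J - {j}" using i by simp
  ultimately have "card ({..<?m} - ?K) = Suc (card ({..<?m} - J - {j}))" by simp
  also have "\<dots> = card ({..<?m} - J)" by (rule card_Suc_Diff1) (use j in simp_all)
  finally have "card ({..<?m} - ?K) = card ({..<?m} - J)" .
  then show "card ({..<?m} - ?K) = card (invs w)"
    using J unfolding sc_facets_iff_card[OF Q] by simp
qed

text \<open>
  Every weight moves in direction \<open>- r(J, i)\<close> or stays. The last position swept certainly moves: its own
  root is the exchanged one, so its weight separates the two indices.
\<close>

lemma facet_exchange_weight:
  assumes j: "j < length Q" "j \<notin> J" and i: "i \<in> J"
    and pair: "{root_src Q J j, root_tgt Q J j} = {root_src Q J i, root_tgt Q J i}"
  shows "\<exists>c :: nat \<Rightarrow> real. (\<forall>k<length Q.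
      weight_fun Q (insert j (J - {i})) k = weight_fun Q J k - c k *\<^sub>R root_fun Q J i) \<and>
    (\<forall>k. 0 \<le> c k) \<and> c (max i j) = 1"
proof -
  let ?a = "root_src Q J i" and ?b = "root_tgt Q J i" and ?K = "insert j (J - {i})"
  have im: "i < length Q" using i facet_subset by auto
  define c :: "nat \<Rightarrow> real" where "c k = (if swept i j k \<and> k < length Q then
      of_bool (inv (prefix_prod Q J k) ?a \<le> Q ! k) - of_bool (inv (prefix_prod Q J k) ?b \<le> Q ! k) else 0)" for k
  have ord: "inv (prefix_prod Q J k) ?a < inv (prefix_prod Q J k) ?b" if "swept i j k" "k < length Q" for k
    using facet_root_order_swept[OF j im that(2,1) pair] .
  have "weight_fun Q ?K k = weight_fun Q J k - c k *\<^sub>R root_fun Q J i" if k: "k < length Q" for k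
  proof (cases "swept i j k")
    case True
    then have "prefix_prod Q ?K k = swp ?a ?b \<circ> prefix_prod Q J k"
      using prefix_prod_exchange[OF i j(2) im j(1) _ pair, of k] k by simp
    from weight_fun_swp[OF this root_src_neq_tgt[OF Q im]] show ?thesis
      using True k by (simp add: c_def root_fun_eq)
  next
    case False
    then have "prefix_prod Q ?K k = prefix_prod Q J k"
      using prefix_prod_exchange[OF i j(2) im j(1) _ pair, of k] k by simp
    then have "weight_fun Q ?K k = weight_fun Q J k"
      by (simp add: vec_eq_iff weight_fun_nth)
    then show ?thesis using False by (simp add: c_def)
  qed
  moreover have "0 \<le> c k" for k
    using ord[of k] by (auto simp: c_def)
  moreover have "c (max i j) = 1"
  proof -
    have "i \<noteq> j" using i j by auto
    then have bt: "swept i j (max i j)" and lt: "max i j < length Q"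
      using im j(1) by (auto simp: swept_def)
    have "{inv (prefix_prod Q J (max i j)) ?a, inv (prefix_prod Q J (max i j)) ?b} = {Q ! max i j, next_index (Q ! max i j)}"
    proof (cases "i \<le> j")
      case True
      then have "{inv (prefix_prod Q J (max i j)) ?a, inv (prefix_prod Q J (max i j)) ?b} =
          inv (prefix_prod Q J j) ` {root_src Q J i, root_tgt Q J i}" by (simp add: max_def)
      also have "\<dots> = {inv (prefix_prod Q J j) (root_src Q J j), inv (prefix_prod Q J j) (root_tgt Q J j)}"
        unfolding pair[symmetric] by simp
      also have "\<dots> = {Q ! max i j, next_index (Q ! max i j)}"
        unfolding inv_prefix_prod_root_src inv_prefix_prod_root_tgt using True by (simp add: max_def)
      finally show ?thesis .
    next
      case False
      then have "max i j = i" by simp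
      then show ?thesis by (simp only: inv_prefix_prod_root_src inv_prefix_prod_root_tgt)
    qed
    then have "inv (prefix_prod Q J (max i j)) ?a = Q ! max i j" "inv (prefix_prod Q J (max i j)) ?b = next_index (Q ! max i j)"
      using ord[OF bt lt] next_index_gt[OF letter_simple[OF Q lt]] by (fastforce simp: doubleton_eq_iff)+
    then show ?thesis
      using bt lt next_index_gt[OF letter_simple[OF Q lt]] by (simp add: c_def not_le)
  qed
  ultimately show ?thesis by (intro exI[of _ c] conjI allI impI)
qed

end

lemma root_exchange:
  assumes "i \<in> J" "j \<notin> J" "i < length Q" "j < length Q" "k < length Q"
    and "{root_src Q J j, root_tgt Q J j} = {root_src Q J i, root_tgt Q J i}"
  shows "root_src Q (insert j (J - {i})) k =
      (if swept i j k then swp (root_src Q J i) (root_tgt Q J i) (root_src Q J k) else root_src Q J k)"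
    and "root_tgt Q (insert j (J - {i})) k =
      (if swept i j k then swp (root_src Q J i) (root_tgt Q J i) (root_tgt Q J k) else root_tgt Q J k)"
  using prefix_prod_exchange[OF assms(1-4) less_imp_le[OF assms(5)] assms(6)]
  by (simp_all add: root_src_def root_tgt_def)

section \<open>Uniqueness of sinks\<close>

lemma facets_above_iff: "J \<in> facets_above Q w I \<longleftrightarrow> J \<in> sc_facets Q w \<and> I \<subseteq> J"
  by (simp add: facets_above_def)

text \<open>
  The total order on the indices is given by an injective rank \<open>\<sigma>\<close>. The positions in \<open>I\<close> are kept
  fixed throughout, which amounts to deleting them from the word without renumbering the others.
\<close>

definition sink :: "'n::{finite,linorder} list \<Rightarrow> nat set \<Rightarrow> ('n \<Rightarrow> nat) \<Rightarrow> nat set \<Rightarrow> bool"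
  where "sink Q I \<sigma> J \<longleftrightarrow> (\<forall>k\<in>J - I. \<sigma> (root_src Q J k) < \<sigma> (root_tgt Q J k))"

text \<open>
  The root at \<open>k\<close> is positive whether \<open>k\<close> is skipped or used, but using the letter exchanges the two
  values of the root. So the product up to and including \<open>k\<close> tells the two cases apart, and a
  facet with positive roots can be reconstructed backwards from \<open>w\<close>.
\<close>

lemma positive_facet_step:
  assumes Q: "set Q \<subseteq> simple_indices" and J: "J \<in> sc_facets Q w"
    and pos: "\<And>k. k \<in> J - I \<Longrightarrow> root_src Q J k < root_tgt Q J k"
    and k: "k < length Q" "k \<notin> I"
  shows "k \<in> J \<longleftrightarrow> prefix_prod Q J (Suc k) (Q ! k) < prefix_prod Q J (Suc k) (next_index (Q ! k))"
proof (cases "k \<in> J")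
  case True
  then show ?thesis
    using pos[of k] k by (simp add: prefix_prod_Suc_mem root_src_def root_tgt_def)
next
  case False
  then show ?thesis
    using facet_root_pos[OF Q J k(1)] k
    by (simp add: prefix_prod_Suc_notin root_src_def root_tgt_def)
qed

lemma positive_facet_unique:
  assumes Q: "set Q \<subseteq> simple_indices"
    and J: "J \<in> facets_above Q w I" and M: "M \<in> facets_above Q w I"
    and pos: "\<And>k. k \<in> J - I \<Longrightarrow> root_src Q J k < root_tgt Q J k"
      "\<And>k. k \<in> M - I \<Longrightarrow> root_src Q M k < root_tgt Q M k"
  shows "J = M"
proof -
  have JM: "J \<in> sc_facets Q w" "I \<subseteq> J" "M \<in> sc_facets Q w" "I \<subseteq> M"
    using J M by (simp_all add: facets_above_iff)
  have "prefix_prod Q J k = prefix_prod Q M k \<and> (\<forall>l\<ge>k. l < length Q \<longrightarrow> (l \<in> J \<longleftrightarrow> l \<in> M))" if "k \<le> length Q" for k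
    using that
  proof (induction k rule: inc_induct)
    case base
    show ?case using facet_prefix_prod_length[OF Q JM(1)] facet_prefix_prod_length[OF Q JM(3)] by simp
  next
    case (step k)
    have k: "k < length Q" using step by simp
    have mem: "k \<in> J \<longleftrightarrow> k \<in> M"
    proof (cases "k \<in> I")
      case True
      then show ?thesis using JM by auto
    next
      case False
      show ?thesis
        using positive_facet_step[OF Q JM(1) pos(1) k False] positive_facet_step[OF Q JM(3) pos(2) k False]
          step.IH by simp
    qed
    have "prefix_prod Q X k = (if k \<in> X then prefix_prod Q X (Suc k) else prefix_prod Q X (Suc k) \<circ> simple_refl (Q ! k))" for X
    proof (cases "k \<in> X")
      case False
      then show ?thesis
        by (simp only: prefix_prod_Suc_notin[OF k False] if_False comp_assoc simple_refl_involutory comp_id)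
    qed (simp add: prefix_prod_Suc_mem[OF k])
    then have "prefix_prod Q J k = prefix_prod Q M k" using mem step.IH by simp
    moreover have "l \<in> J \<longleftrightarrow> l \<in> M" if "k \<le> l" "l < length Q" for l
      using mem step.IH that by (cases "l = k") auto
    ultimately show ?case by blast
  qed
  from this[of 0] have "\<And>l. l < length Q \<Longrightarrow> l \<in> J \<longleftrightarrow> l \<in> M" by simp
  then show ?thesis using facet_subset[OF Q JM(1)] facet_subset[OF Q JM(3)] by blast
qed

text \<open>
  Exchanging two neighbours in the order given by \<open>\<sigma>\<close> affects no other comparison.
\<close>

lemma adjacent_swp_less:
  fixes \<sigma> :: "'n \<Rightarrow> nat"
  assumes "inj \<sigma>" "\<sigma> b < \<sigma> a" "\<And>c. \<not> (\<sigma> b < \<sigma> c \<and> \<sigma> c < \<sigma> a)"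
    and "\<sigma> x < \<sigma> y" "{x, y} \<noteq> {a, b}"
  shows "\<sigma> (swp a b x) < \<sigma> (swp a b y)"
proof -
  have "\<sigma> c \<le> \<sigma> b \<or> \<sigma> a \<le> \<sigma> c" for c using assms(3)[of c] by linarith
  then have tri: "c = a \<or> c = b \<or> \<sigma> c < \<sigma> b \<or> \<sigma> a < \<sigma> c" for c
    using assms(1) by (metis injD le_neq_implies_less)
  show ?thesis
    using tri[of x] tri[of y] assms(2,4,5) by (auto simp: Transposition.transpose_def)
qed

text \<open>
  An inversion of \<open>\<sigma>\<close> with the fewest values in between has none: a value in between would form an
  inversion with one of the two ends.
\<close>

lemma ex_adjacent_inversion:
  fixes \<sigma> :: "'n::{finite,linorder} \<Rightarrow> nat"
  assumes "a0 < b0" "\<sigma> b0 < \<sigma> a0"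
  shows "\<exists>a b. a < b \<and> \<sigma> b < \<sigma> a \<and> (\<forall>c. \<not> (\<sigma> b < \<sigma> c \<and> \<sigma> c < \<sigma> a))"
proof -
  define N where "N ab = card {c. \<sigma> (snd ab) < \<sigma> c \<and> \<sigma> c < \<sigma> (fst ab)}" for ab
  define P where "P ab \<longleftrightarrow> fst ab < snd ab \<and> \<sigma> (snd ab) < \<sigma> (fst ab)" for ab :: "'n \<times> 'n"
  have "P (a0, b0)" using assms by (simp add: P_def)
  then obtain ab where ab: "P ab" "\<And>cd. P cd \<Longrightarrow> N ab \<le> N cd"
    using ex_has_least_nat[of P "(a0, b0)" N] by blast
  obtain a b where [simp]: "ab = (a, b)" by (cases ab)
  have less: "N (a', b') < N (a, b)"
    if "\<sigma> b \<le> \<sigma> b'" "\<sigma> a' \<le> \<sigma> a" "\<sigma> b < \<sigma> c" "\<sigma> c < \<sigma> a" "\<not> (\<sigma> b' < \<sigma> c \<and> \<sigma> c < \<sigma> a')" for a' b' c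
    unfolding N_def using that by (intro psubset_card_mono) auto
  have "\<not> (\<sigma> b < \<sigma> c \<and> \<sigma> c < \<sigma> a)" for c
  proof
    assume c: "\<sigma> b < \<sigma> c \<and> \<sigma> c < \<sigma> a"
    show False
    proof (cases "a < c")
      case True
      then show False using ab(2)[of "(a, c)"] less[of c a c] c by (auto simp: P_def)
    next
      case False
      then have "c < b" using ab(1) by (auto simp: P_def)
      then show False using ab(2)[of "(c, b)"] less[of b c c] c by (auto simp: P_def)
    qed
  qed
  then show ?thesis using ab(1) by (intro exI[of _ a] exI[of _ b]) (auto simp: P_def)
qed

definition pair_positions ::
    "'n::{finite,linorder} list \<Rightarrow> nat set \<Rightarrow> 'n \<Rightarrow> 'n \<Rightarrow> nat set \<Rightarrow> nat set"
  where "pair_positions Q I a b J =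
    {k. k < length Q \<and> k \<notin> I \<and> {root_src Q J k, root_tgt Q J k} = {a, b}}"

text \<open>
  Passing from the order \<open>\<sigma>\<close> to the one with the neighbours \<open>a\<close> and \<open>b\<close> exchanged affects only the
  positions with unordered root \<open>{a, b}\<close>. If there are any, the first one is used and the others are
  skipped, so exchanging the first and the last one reflects the roots of all skipped ones. The set of
  these positions is the same before and after the exchange, which can therefore be undone knowing only
  its result.
\<close>

lemma sink_push_down:
  assumes Q: "set Q \<subseteq> simple_indices" and J: "J \<in> facets_above Q w I" and sink: "sink Q I \<sigma> J"
    and \<sigma>: "inj \<sigma>" and ab: "a < b" "\<sigma> b < \<sigma> a" and adj: "\<And>c. \<not> (\<sigma> b < \<sigma> c \<and> \<sigma> c < \<sigma> a)"
  obtains K where "K \<in> facets_above Q w I" "sink Q I (\<sigma> \<circ> swp a b) K"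
    "J = (if pair_positions Q I a b K = {} then K
      else insert (Max (pair_positions Q I a b K)) K - {Min (pair_positions Q I a b K)})"
proof -
  define S where "S = pair_positions Q I a b J"
  note S_def = S_def[unfolded pair_positions_def]
  have JF: "J \<in> sc_facets Q w" and IJ: "I \<subseteq> J" using J by (simp_all add: facets_above_iff)
  note sub = facet_subset[OF Q JF]
  have fin: "finite S" by (simp add: S_def)
  have less: "(\<sigma> \<circ> swp a b) (root_src Q J k) < (\<sigma> \<circ> swp a b) (root_tgt Q J k)"
    if "k \<in> J - I" "k \<notin> S" for k
  proof -
    have "{root_src Q J k, root_tgt Q J k} \<noteq> {a, b}" using that sub by (auto simp: S_def)
    moreover have "\<sigma> (root_src Q J k) < \<sigma> (root_tgt Q J k)" using sink that by (simp add: sink_def)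
    ultimately show ?thesis using adjacent_swp_less[OF \<sigma> ab(2) adj] by simp
  qed
  show ?thesis
  proof (cases "S \<inter> J = {}")
    case True
    have single: "S = {} \<or> (\<exists>i. S = {i} \<and> i \<notin> J)"
    proof -
      have "i = k" if "i \<in> S" "k \<in> S" for i k
      proof -
        have *: "(root_src Q J l, root_tgt Q J l) = (a, b)" "l < length Q" "l \<notin> J" if "l \<in> S" for l
        proof -
          show l: "l < length Q" "l \<notin> J" using that True by (auto simp: S_def)
          have "{root_src Q J l, root_tgt Q J l} = {a, b}" using that by (simp add: S_def)
          then show "(root_src Q J l, root_tgt Q J l) = (a, b)"
            using facet_root_pos[OF Q JF l] ab(1) unfolding doubleton_eq_iff by auto
        qed
        have "\<not> i < k"
          using facet_root_in_invs_prefix_prod_iff[OF Q JF *(2,3)[OF \<open>i \<in> S\<close>], of k] *[OF \<open>i \<in> S\<close>] *[OF \<open>k \<in> S\<close>]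
            root_notin_invs_prefix_prod[OF Q *(2)[OF \<open>k \<in> S\<close>], of J] by (metis less_imp_le_nat)
        moreover have "\<not> k < i"
          using facet_root_in_invs_prefix_prod_iff[OF Q JF *(2,3)[OF \<open>k \<in> S\<close>], of i] *[OF \<open>i \<in> S\<close>] *[OF \<open>k \<in> S\<close>]
            root_notin_invs_prefix_prod[OF Q *(2)[OF \<open>i \<in> S\<close>], of J] by (metis less_imp_le_nat)
        ultimately show ?thesis by simp
      qed
      then have "S = {} \<or> (\<exists>i. S = {i})" by blast
      then show ?thesis using True by blast
    qed
    have "sink Q I (\<sigma> \<circ> swp a b) J"
      unfolding sink_def using less True by blast
    moreover have "pair_positions Q I a b J = S" by (simp add: S_def pair_positions_def)
    ultimately show ?thesis using J single by (intro that[of J]) auto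
  next
    case False
    have rev: "root_src Q J k = b" "root_tgt Q J k = a" if "k \<in> S \<inter> J" for k
    proof -
      have "\<sigma> (root_src Q J k) < \<sigma> (root_tgt Q J k)" "{root_src Q J k, root_tgt Q J k} = {a, b}"
        using that sink by (auto simp: S_def sink_def)
      then show "root_src Q J k = b" "root_tgt Q J k = a"
        using ab(2) unfolding doubleton_eq_iff by auto
    qed
    have inverted: "(a, b) \<in> invs (prefix_prod Q J k)" if "k \<in> S \<inter> J" for k
    proof -
      have "k < length Q" using that by (simp add: S_def)
      from root_reversed_in_invs_prefix_prod[OF Q this, of J] show ?thesis unfolding rev[OF that] using ab(1) .
    qed
    from False obtain k0 where k0: "k0 \<in> S \<inter> J" by blast
    then have "k0 \<le> length Q" by (simp add: S_def)
    from facet_mem_invs_prefix_prod[OF Q JF this, THEN iffD1, OF inverted[OF k0]]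
    obtain i where i: "i < k0" "i \<notin> J" "root_src Q J i = a" "root_tgt Q J i = b"
      unfolding prod.inject by (elim exE conjE) simp
    have im: "i < length Q" using i(1) k0 by (simp add: S_def)
    have iS: "i \<in> S" using i im IJ by (auto simp: S_def)
    have others: "k \<in> J \<and> i < k" if "k \<in> S" "k \<noteq> i" for k
    proof -
      have k: "k < length Q" "{root_src Q J k, root_tgt Q J k} = {a, b}" using that by (simp_all add: S_def)
      have "(a, b) \<in> invs (prefix_prod Q J k) \<longleftrightarrow> i < k"
        using facet_root_in_invs_prefix_prod_iff[OF Q JF im i(2), of k] i k by simp
      moreover have "k \<in> J"
      proof (rule ccontr)
        assume kJ: "k \<notin> J"
        have eq: "root_src Q J k = a" "root_tgt Q J k = b"
          using facet_root_pos[OF Q JF k(1) kJ] k(2) ab(1) unfolding doubleton_eq_iff by auto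
        have "\<not> i < k"
          using root_notin_invs_prefix_prod[OF Q k(1), of J] eq calculation by simp
        moreover have "\<not> k < i"
          using facet_root_in_invs_prefix_prod_iff[OF Q JF k(1) kJ, of i] root_notin_invs_prefix_prod[OF Q im, of J] eq i(3,4) im
          by simp
        ultimately show False using that by simp
      qed
      ultimately show ?thesis using inverted[of k] that by blast
    qed
    define l where "l = Max S"
    have lS: "l \<in> S" unfolding l_def by (rule Max_in) (use fin iS in auto)
    have "k0 \<le> l" unfolding l_def using k0 fin by (intro Max_ge) auto
    then have il: "i < l" using i(1) by simp
    then have lJ: "l \<in> J" using others[OF lS] by simp
    have lI: "l \<notin> I" "l < length Q" using lS by (simp_all add: S_def)
    have Min: "Min S = i"
      by (rule Min_eqI) (use fin iS others in \<open>auto intro: less_imp_le\<close>)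
    have rl: "root_src Q J l = b" "root_tgt Q J l = a" using rev[of l] lS lJ by auto
    have pair: "{root_src Q J i, root_tgt Q J i} = {root_src Q J l, root_tgt Q J l}"
      unfolding rl i(3,4) by (rule insert_commute)
    define K where "K = insert i (J - {l})"
    have K: "K \<in> facets_above Q w I"
      unfolding facets_above_iff K_def
      using facet_exchange[OF Q JF im i(2) lJ pair] IJ lI(1) by auto
    have root_K: "root_src Q K k = (if swept l i k then swp a b (root_src Q J k) else root_src Q J k)"
      "root_tgt Q K k = (if swept l i k then swp a b (root_tgt Q J k) else root_tgt Q J k)"
      if "k < length Q" for k
      using root_exchange[OF lJ i(2) lI(2) im that pair] unfolding K_def rl
      by (simp_all only: transpose_commute[of b a])
    have swp_pair: "{swp a b x, swp a b y} = {a, b} \<longleftrightarrow> {x, y} = {a, b}" for x y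
      unfolding doubleton_eq_iff by (auto simp: Transposition.transpose_def split: if_splits)
    have "{root_src Q K k, root_tgt Q K k} = {a, b} \<longleftrightarrow> {root_src Q J k, root_tgt Q J k} = {a, b}"
      if "k < length Q" for k
      using root_K[OF that] swp_pair by simp
    then have SK: "pair_positions Q I a b K = S"
      unfolding S_def pair_positions_def by auto
    have "sink Q I (\<sigma> \<circ> swp a b) K"
      unfolding sink_def
    proof
      fix k assume k: "k \<in> K - I"
      then have km: "k < length Q" using sub im by (auto simp: K_def)
      show "(\<sigma> \<circ> swp a b) (root_src Q K k) < (\<sigma> \<circ> swp a b) (root_tgt Q K k)"
      proof (cases "k = i")
        case True
        then have "\<not> swept l i k" using il by (simp add: swept_def)
        then show ?thesis using root_K[OF km] True i(3,4) ab(2) by simp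
      next
        case False
        then have kJ: "k \<in> J - I" "k \<noteq> l" using k by (auto simp: K_def)
        show ?thesis
        proof (cases "swept l i k")
          case True
          have "\<sigma> (root_src Q J k) < \<sigma> (root_tgt Q J k)" using sink kJ by (simp add: sink_def)
          then show ?thesis using root_K[OF km] True by simp
        next
          case ns: False
          have "k \<notin> S"
          proof
            assume "k \<in> S"
            then have "i < k" "k \<le> l" using others False fin by (auto simp: l_def)
            then show False using ns by (simp add: swept_def)
          qed
          then show ?thesis using less[OF kJ(1)] root_K[OF km] ns by simp
        qed
      qed
    qed
    moreover have "J = insert l K - {i}" using lJ i(2) by (auto simp: K_def)
    ultimately show ?thesis
      using K iS by (intro that[of K]) (auto simp: SK Min l_def)
  qed
qed

text \<open>
  Induction on the number of inversions of \<open>\<sigma>\<close>: the push to an order with fewer inversions is injective.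
\<close>

lemma sink_unique:
  assumes Q: "set Q \<subseteq> simple_indices" and \<sigma>: "inj \<sigma>"
    and J: "J \<in> facets_above Q w I" "sink Q I \<sigma> J"
    and M: "M \<in> facets_above Q w I" "sink Q I \<sigma> M"
  shows "J = M"
  using \<sigma> J M
proof (induction "card {(a, b). a < b \<and> \<sigma> b < \<sigma> a}" arbitrary: \<sigma> J M rule: less_induct)
  case less
  show ?case
  proof (cases "\<exists>a b. a < b \<and> \<sigma> b < \<sigma> a")
    case False
    have ord: "x < y" if "\<sigma> x < \<sigma> y" for x y
      using False that by (metis less_asym linorder_neqE)
    show ?thesis
      using less.prems ord by (intro positive_facet_unique[OF Q]) (auto simp: sink_def)
  next
    case True
    then obtain a0 b0 where "a0 < b0" "\<sigma> b0 < \<sigma> a0" by blast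
    from ex_adjacent_inversion[of a0 b0 \<sigma>, OF this]
    obtain a b where ab: "a < b" "\<sigma> b < \<sigma> a" and "\<forall>c. \<not> (\<sigma> b < \<sigma> c \<and> \<sigma> c < \<sigma> a)"
      by (elim exE conjE)
    then have adj: "\<And>c. \<not> (\<sigma> b < \<sigma> c \<and> \<sigma> c < \<sigma> a)" by blast
    let ?\<sigma> = "\<sigma> \<circ> swp a b"
    have inj: "inj ?\<sigma>" using less.prems(1) by (intro inj_compose) auto
    have "(x, y) \<in> {(x, y). x < y \<and> \<sigma> y < \<sigma> x}"
      if "x < y" "?\<sigma> y < ?\<sigma> x" for x y
    proof -
      have "\<sigma> x \<noteq> \<sigma> y" using \<open>x < y\<close> less.prems(1) by (auto dest: injD)
      moreover have "\<not> \<sigma> x < \<sigma> y"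
      proof
        assume xy: "\<sigma> x < \<sigma> y"
        then have "{x, y} \<noteq> {a, b}" using ab \<open>x < y\<close> unfolding doubleton_eq_iff by auto
        from adjacent_swp_less[OF less.prems(1) ab(2) adj xy this] that(2) show False by simp
      qed
      ultimately show ?thesis using \<open>x < y\<close> by simp
    qed
    moreover have "(a, b) \<notin> {(x, y). x < y \<and> ?\<sigma> y < ?\<sigma> x}" using ab by simp
    ultimately have "{(x, y). x < y \<and> ?\<sigma> y < ?\<sigma> x} \<subset> {(x, y). x < y \<and> \<sigma> y < \<sigma> x}"
      using ab by blast
    then have card: "card {(x, y). x < y \<and> ?\<sigma> y < ?\<sigma> x} < card {(x, y). x < y \<and> \<sigma> y < \<sigma> x}"
      by (intro psubset_card_mono) auto
    obtain J' where J': "J' \<in> facets_above Q w I" "sink Q I ?\<sigma> J'"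
      "J = (if pair_positions Q I a b J' = {} then J'
        else insert (Max (pair_positions Q I a b J')) J' - {Min (pair_positions Q I a b J')})"
      by (rule sink_push_down[OF Q less.prems(2,3,1) ab adj])
    obtain M' where M': "M' \<in> facets_above Q w I" "sink Q I ?\<sigma> M'"
      "M = (if pair_positions Q I a b M' = {} then M'
        else insert (Max (pair_positions Q I a b M')) M' - {Min (pair_positions Q I a b M')})"
      by (rule sink_push_down[OF Q less.prems(4,5,1) ab adj])
    have "J' = M'" by (rule less.hyps[OF card inj J'(1,2) M'(1,2)])
    then show ?thesis using J'(3) M'(3) by (simp only:)
  qed
qed

section \<open>Facets minimising a linear functional\<close>

text \<open>
  The order on the indices that sorts the coordinates of \<open>f\<close> decreasingly and breaks ties by the given
  order. It corresponds to the functional \<open>f + \<epsilon> decreasing_functional\<close> for small \<open>\<epsilon> > 0\<close>.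
\<close>

definition functional_rank :: "(real, 'n::{finite,linorder}) vec \<Rightarrow> 'n \<Rightarrow> nat"
  where "functional_rank f a = card {c. f $ a < f $ c \<or> f $ c = f $ a \<and> c < a}"

lemma functional_rank_less_iff:
  "functional_rank f a < functional_rank f b \<longleftrightarrow> f $ b < f $ a \<or> f $ a = f $ b \<and> a < b"
proof -
  have less: "functional_rank f a < functional_rank f b"
    if "f $ b < f $ a \<or> f $ a = f $ b \<and> a < b" for a b
    unfolding functional_rank_def
  proof (rule psubset_card_mono)
    have "a \<in> {c. f $ b < f $ c \<or> f $ c = f $ b \<and> c < b}"
      "a \<notin> {c. f $ a < f $ c \<or> f $ c = f $ a \<and> c < a}" using that by auto
    moreover have "{c. f $ a < f $ c \<or> f $ c = f $ a \<and> c < a} \<subseteq>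
        {c. f $ b < f $ c \<or> f $ c = f $ b \<and> c < b}"
      using that by auto
    ultimately show "{c. f $ a < f $ c \<or> f $ c = f $ a \<and> c < a} \<subset>
        {c. f $ b < f $ c \<or> f $ c = f $ b \<and> c < b}" by blast
  qed simp
  show ?thesis
  proof
    assume lt: "functional_rank f a < functional_rank f b"
    then have "a \<noteq> b" by auto
    moreover have "\<not> (f $ a < f $ b \<or> f $ b = f $ a \<and> b < a)" using less[of a b] lt by auto
    ultimately show "f $ b < f $ a \<or> f $ a = f $ b \<and> a < b" by (auto simp: not_less le_less)
  qed (rule less)
qed

lemma inj_functional_rank: "inj (functional_rank f)"
proof (rule injI)
  fix a b assume "functional_rank f a = functional_rank f b"
  then have "\<not> functional_rank f a < functional_rank f b" "\<not> functional_rank f b < functional_rank f a"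
    by simp_all
  then show "a = b" unfolding functional_rank_less_iff by (auto simp: not_less)
qed

definition weak_sink :: "'n::{finite,linorder} list \<Rightarrow> nat set \<Rightarrow> (real, 'n) vec \<Rightarrow> nat set \<Rightarrow> bool"
  where "weak_sink Q I f J \<longleftrightarrow> (\<forall>k\<in>J - I. 0 \<le> f \<bullet> root_fun Q J k)"

definition pos_positions ::
    "'n::{finite,linorder} list \<Rightarrow> nat set \<Rightarrow> (real, 'n) vec \<Rightarrow> nat set \<Rightarrow> nat set"
  where "pos_positions Q I f J = {k \<in> J - I. 0 < f \<bullet> root_fun Q J k}"

definition decreasing_functional :: "(real, 'n::{finite,linorder}) vec"
  where "decreasing_functional = (\<chi> x. - real (card {c. c < x}))"

lemma decreasing_functional_less:
  assumes "a < b"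
  shows "decreasing_functional $ b < decreasing_functional $ a"
proof -
  have "{c. c < a} \<subset> {c. c < b}" using assms by (auto dest: less_trans)
  then have "card {c. c < a} < card {c. c < b}" by (intro psubset_card_mono) auto
  then show ?thesis by (simp add: decreasing_functional_def)
qed

lemma finite_facets_above: "finite (facets_above Q w I)"
proof (rule finite_subset)
  show "facets_above Q w I \<subseteq> Pow {..<length Q}"
    by (auto simp: facets_above_def sc_facets_def)
qed simp

lemma ex_min_on:
  fixes h :: "'a \<Rightarrow> real"
  assumes "finite S" "S \<noteq> {}"
  shows "\<exists>x\<in>S. \<forall>y\<in>S. h x \<le> h y"
proof -
  have "Min (h ` S) \<in> h ` S" using assms by (intro Min_in) auto
  then obtain x where "x \<in> S" "h x = Min (h ` S)" by auto
  then show ?thesis using assms by (intro bexI[of _ x]) auto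
qed

text \<open>
  Minimising lexicographically replaces functionals with infinitesimal perturbations.
\<close>

lemma ex_lex_min_on:
  fixes A B C :: "'a \<Rightarrow> real"
  assumes "finite S" "S \<noteq> {}"
  shows "\<exists>x\<in>S. \<forall>y\<in>S. A x \<le> A y \<and> (A y = A x \<longrightarrow> B x \<le> B y \<and> (B y = B x \<longrightarrow> C x \<le> C y))"
proof -
  obtain x where x: "x \<in> S" "\<forall>y\<in>S. A x \<le> A y" using ex_min_on[OF assms] by blast
  let ?S1 = "{y \<in> S. A y = A x}"
  have "finite ?S1" "?S1 \<noteq> {}" using assms x by auto
  then obtain y where y: "y \<in> ?S1" "\<forall>z\<in>?S1. B y \<le> B z" using ex_min_on by blast
  let ?S2 = "{z \<in> ?S1. B z = B y}"
  have "finite ?S2" "?S2 \<noteq> {}" using assms y by auto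
  then obtain z where z: "z \<in> ?S2" "\<forall>u\<in>?S2. C z \<le> C u" using ex_min_on by blast
  show ?thesis
    using x(2) y(2) z by (intro bexI[of _ z]) auto
qed

lemma flip:
  assumes Q: "set Q \<subseteq> simple_indices" and J: "J \<in> facets_above Q w I" and i: "i \<in> J - I"
    and ab: "{root_src Q J i, root_tgt Q J i} = {a, b}" "(a, b) \<in> invs w"
  obtains j c C where "j < length Q" "j \<notin> J" "root_src Q J j = a" "root_tgt Q J j = b"
    "insert j (J - {i}) \<in> facets_above Q w I"
    "\<And>k. k < length Q \<Longrightarrow>
      weight_fun Q (insert j (J - {i})) k = weight_fun Q J k - c k *\<^sub>R root_fun Q J i"
    "\<And>k. 0 \<le> c k" "c (max i j) = 1"
    "brick_vector Q (insert j (J - {i})) = brick_vector Q J + C *\<^sub>R root_fun Q J i" "(0::real) < C"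
proof -
  have JF: "J \<in> sc_facets Q w" and IJ: "I \<subseteq> J" using J by (simp_all add: facets_above_iff)
  from facet_mem_invs[OF Q JF, THEN iffD1, OF ab(2)]
  obtain j where j: "j < length Q" "j \<notin> J" "root_src Q J j = a" "root_tgt Q J j = b"
    unfolding prod.inject by (elim exE conjE) simp
  have iJ: "i \<in> J" using i by simp
  have pair: "{root_src Q J j, root_tgt Q J j} = {root_src Q J i, root_tgt Q J i}"
    unfolding ab(1) j(3,4) ..
  from facet_exchange_weight[OF Q JF j(1,2) iJ pair]
  obtain c where "\<forall>k<length Q.
      weight_fun Q (insert j (J - {i})) k = weight_fun Q J k - c k *\<^sub>R root_fun Q J i"
    "\<forall>k. 0 \<le> c k" "c (max i j) = (1::real)"
    by (elim exE conjE)
  then have c: "\<And>k. k < length Q \<Longrightarrow>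
      weight_fun Q (insert j (J - {i})) k = weight_fun Q J k - c k *\<^sub>R root_fun Q J i"
    "\<And>k. 0 \<le> c k" "c (max i j) = (1::real)" by simp_all
  define C where "C = (\<Sum>k<length Q. c k)"
  have lt: "max i j < length Q" using iJ j(1) facet_subset[OF Q JF] by auto
  have "c (max i j) \<le> C"
    unfolding C_def by (intro member_le_sum) (use lt c(2) in auto)
  then have "0 < C" using c(3) by simp
  have "brick_vector Q (insert j (J - {i})) = brick_vector Q J + C *\<^sub>R root_fun Q J i"
    unfolding brick_vector_def C_def
    by (simp add: c(1) sum_subtractf scaleR_left.sum)
  moreover have "insert j (J - {i}) \<in> facets_above Q w I"
    using facet_exchange[OF Q JF j(1,2) iJ pair] IJ i by (auto simp: facets_above_iff)
  ultimately show ?thesis using c \<open>0 < C\<close> by (intro that[of j c C] j)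
qed

text \<open>
  A negative root at a skipped position means that its pair has been inverted before. So a position
  with a negative root can always be flipped.
\<close>

lemma negative_root_inverted:
  assumes Q: "set Q \<subseteq> simple_indices" and J: "J \<in> sc_facets Q w" and i: "i \<in> J"
    and neg: "root_tgt Q J i < root_src Q J i"
  shows "(root_tgt Q J i, root_src Q J i) \<in> invs w"
proof -
  have "i < length Q" using i facet_subset[OF Q J] by auto
  then show ?thesis
    using root_reversed_in_invs_prefix_prod[OF Q _ neg] facet_invs_prefix_prod_subset[OF Q J, of i] by auto
qed

text \<open>
  Among the facets that \<open>f\<close> cannot distinguish from \<open>J\<close>, take one that minimises the tie-breaking
  functional. A root with \<open>f\<close>-value \<open>0\<close> that still has the wrong sign is negative, hence flippable, and
  the flip changes no value of \<open>f\<close> but decreases the tie-breaking functional.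
\<close>

lemma weak_sink_perturb:
  assumes Q: "set Q \<subseteq> simple_indices" and J: "J \<in> facets_above Q w I" "weak_sink Q I f J"
  obtains K where "K \<in> facets_above Q w I" "sink Q I (functional_rank f) K"
    "\<And>k. k < length Q \<Longrightarrow> f \<bullet> weight_fun Q K k = f \<bullet> weight_fun Q J k"
    "pos_positions Q I f K = pos_positions Q I f J"
proof -
  define S where "S = {K \<in> facets_above Q w I. weak_sink Q I f K \<and>
    (\<forall>k<length Q. f \<bullet> weight_fun Q K k = f \<bullet> weight_fun Q J k) \<and>
    pos_positions Q I f K = pos_positions Q I f J}"
  let ?h = "\<lambda>K. decreasing_functional \<bullet> brick_vector Q K"
  have "finite S" "S \<noteq> {}" using finite_facets_above[of Q w I] J by (auto simp: S_def)
  then obtain K where K: "K \<in> S" "\<And>L. L \<in> S \<Longrightarrow> ?h K \<le> ?h L" using ex_min_on[of S ?h] by blast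
  have KS: "K \<in> facets_above Q w I" "weak_sink Q I f K"
    "\<And>k. k < length Q \<Longrightarrow> f \<bullet> weight_fun Q K k = f \<bullet> weight_fun Q J k"
    "pos_positions Q I f K = pos_positions Q I f J" using K(1) by (simp_all add: S_def)
  have KF: "K \<in> sc_facets Q w" using KS(1) by (simp add: facets_above_iff)
  have "sink Q I (functional_rank f) K"
    unfolding sink_def
  proof
    fix i assume i: "i \<in> K - I"
    have im: "i < length Q" using i facet_subset[OF Q KF] by auto
    show "functional_rank f (root_src Q K i) < functional_rank f (root_tgt Q K i)"
    proof (rule ccontr)
      assume not: "\<not> ?thesis"
      have "0 \<le> f \<bullet> root_fun Q K i" using KS(2) i by (simp add: weak_sink_def)
      then have zero: "f $ root_src Q K i = f $ root_tgt Q K i"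
        using not by (simp add: functional_rank_less_iff inner_root_fun)
      then have neg: "root_tgt Q K i < root_src Q K i"
        using not root_src_neq_tgt[OF Q im, of K] by (simp add: functional_rank_less_iff not_less le_less)
      have pair: "{root_src Q K i, root_tgt Q K i} = {root_tgt Q K i, root_src Q K i}"
        by (rule insert_commute)
      have inv: "(root_tgt Q K i, root_src Q K i) \<in> invs w"
        using negative_root_inverted[OF Q KF _ neg] i by simp
      obtain j c C where j: "j < length Q" "j \<notin> K" "root_src Q K j = root_tgt Q K i" "root_tgt Q K j = root_src Q K i"
        "insert j (K - {i}) \<in> facets_above Q w I"
        and W: "\<And>k. k < length Q \<Longrightarrow>
          weight_fun Q (insert j (K - {i})) k = weight_fun Q K k - c k *\<^sub>R root_fun Q K i"
        and C: "brick_vector Q (insert j (K - {i})) = brick_vector Q K + C *\<^sub>R root_fun Q K i" "(0::real) < C"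
        by (rule flip[OF Q KS(1) i pair inv]) blast
      let ?L = "insert j (K - {i})"
      have fz: "f \<bullet> root_fun Q K i = 0" using zero by (simp add: inner_root_fun)
      have iK: "i \<in> K" using i by simp
      have pair': "{root_src Q K j, root_tgt Q K j} = {root_src Q K i, root_tgt Q K i}"
        unfolding j(3,4) by (rule insert_commute)
      have fswp: "f $ swp (root_src Q K i) (root_tgt Q K i) x = f $ x" for x
        using zero by (auto simp: Transposition.transpose_def)
      have fr: "f \<bullet> root_fun Q ?L k = f \<bullet> root_fun Q K k" if "k < length Q" for k
        using root_exchange[OF iK j(2) im j(1) that pair'] fswp by (simp add: inner_root_fun)
      have frj: "f \<bullet> root_fun Q ?L j = 0"
        using fr[OF j(1)] zero j(3,4) by (simp add: inner_root_fun)
      have fr': "f \<bullet> root_fun Q ?L k = f \<bullet> root_fun Q K k" if "k \<in> K" for k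
        using fr that facet_subset[OF Q KF] by auto
      have "weak_sink Q I f ?L"
        using KS(2) fr' frj by (auto simp: weak_sink_def)
      moreover have "pos_positions Q I f ?L = pos_positions Q I f K"
        using fr' frj fz unfolding pos_positions_def by auto
      moreover have "f \<bullet> weight_fun Q ?L k = f \<bullet> weight_fun Q J k" if "k < length Q" for k
        using W[OF that] KS(3)[OF that] fz by (simp add: inner_diff_right)
      ultimately have "?L \<in> S" using j(5) KS(4) by (simp add: S_def)
      then have "?h K \<le> ?h ?L" by (rule K(2))
      moreover have "decreasing_functional \<bullet> root_fun Q K i < 0"
        using decreasing_functional_less[OF neg] by (simp add: inner_root_fun)
      ultimately show False
        using mult_pos_neg[OF C(2), of "decreasing_functional \<bullet> root_fun Q K i"] C(1)
        by (simp add: inner_add_right)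
    qed
  qed
  then show ?thesis using that KS(1,3,4) by blast
qed

text \<open>
  Minimise lexicographically minus the value of \<open>f\<close> on the weight at \<open>k0\<close>, the value of \<open>f\<close> on the
  brick vector, and the value of the tie-breaking functional on it. A minimiser \<open>M\<close> has only roots that ascend in the order of \<open>f\<close>: every position of \<open>M\<close> can be flipped, and a
  flip along a descending root would lower one of the three values without raising an earlier one.
  By uniqueness \<open>M\<close> is the perturbation
  of \<open>J\<close>. The weight at the single position \<open>k0\<close> comes first, so \<open>J\<close> is optimal at that position.
\<close>

lemma weak_sink_weight_max_if_all_inverted:
  assumes Q: "set Q \<subseteq> simple_indices" and all: "\<And>a b. a < b \<Longrightarrow> (a, b) \<in> invs w"
    and J: "J \<in> facets_above Q w I" "weak_sink Q I f J" and K: "K \<in> facets_above Q w I"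
    and k0: "k0 < length Q"
  shows "f \<bullet> weight_fun Q K k0 \<le> f \<bullet> weight_fun Q J k0"
proof -
  let ?A = "\<lambda>K. - (f \<bullet> weight_fun Q K k0)" and ?B = "\<lambda>K. f \<bullet> brick_vector Q K"
    and ?C = "\<lambda>K. decreasing_functional \<bullet> brick_vector Q K"
  have "facets_above Q w I \<noteq> {}" using K by blast
  then obtain M where M: "M \<in> facets_above Q w I"
    and min: "\<And>L. L \<in> facets_above Q w I \<Longrightarrow>
      ?A M \<le> ?A L \<and> (?A L = ?A M \<longrightarrow> ?B M \<le> ?B L \<and> (?B L = ?B M \<longrightarrow> ?C M \<le> ?C L))"
    using ex_lex_min_on[OF finite_facets_above, of Q w I ?A ?B ?C] by blast
  have MF: "M \<in> sc_facets Q w" using M by (simp add: facets_above_iff)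
  have "sink Q I (functional_rank f) M"
    unfolding sink_def
  proof
    fix i assume i: "i \<in> M - I"
    have im: "i < length Q" using i facet_subset[OF Q MF] by auto
    let ?a = "min (root_src Q M i) (root_tgt Q M i)" and ?b = "max (root_src Q M i) (root_tgt Q M i)"
    have ne: "root_src Q M i \<noteq> root_tgt Q M i" by (rule root_src_neq_tgt[OF Q im])
    then have "?a < ?b" by (auto simp: min_def max_def)
    then have inv: "(?a, ?b) \<in> invs w" by (rule all)
    have pair: "{root_src Q M i, root_tgt Q M i} = {?a, ?b}" by (auto simp: min_def max_def)
    show "functional_rank f (root_src Q M i) < functional_rank f (root_tgt Q M i)"
    proof (rule ccontr)
      assume not: "\<not> ?thesis"
      obtain j c C where L: "insert j (M - {i}) \<in> facets_above Q w I"
        and W: "\<And>k. k < length Q \<Longrightarrow>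
          weight_fun Q (insert j (M - {i})) k = weight_fun Q M k - c k *\<^sub>R root_fun Q M i"
        and c: "\<And>k. (0::real) \<le> c k"
        and C: "brick_vector Q (insert j (M - {i})) = brick_vector Q M + C *\<^sub>R root_fun Q M i" "(0::real) < C"
        by (rule flip[OF Q M i pair inv]) blast
      let ?L = "insert j (M - {i})"
      let ?r = "f \<bullet> root_fun Q M i"
      have A: "?A ?L = ?A M + c k0 * ?r" using W[OF k0] by (simp add: inner_diff_right)
      have B: "?B ?L = ?B M + C * ?r" using C by (simp add: inner_add_right)
      have "?r \<le> 0" using not by (auto simp: functional_rank_less_iff inner_root_fun)
      then consider "?r < 0" | "?r = 0" by linarith
      then show False
      proof cases
        case 1
        then have "c k0 * ?r \<le> 0" "C * ?r < 0"
          using c[of k0] C(2) by (simp_all add: mult_nonneg_nonpos mult_pos_neg)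
        then show False using min[OF L] A B by linarith
      next
        case 2
        then have "root_tgt Q M i < root_src Q M i"
          using not ne by (auto simp: functional_rank_less_iff inner_root_fun)
        from decreasing_functional_less[OF this]
        have "decreasing_functional \<bullet> root_fun Q M i < 0" by (simp add: inner_root_fun)
        then have "C * (decreasing_functional \<bullet> root_fun Q M i) < 0" using C(2) by (rule mult_pos_neg[rotated])
        moreover have "?C ?L = ?C M + C * (decreasing_functional \<bullet> root_fun Q M i)"
          using C(1) by (simp add: inner_add_right)
        moreover have "?A ?L = ?A M" "?B ?L = ?B M" using A B 2 by simp_all
        ultimately show False using min[OF L] by linarith
      qed
    qed
  qed
  moreover obtain J' where J': "J' \<in> facets_above Q w I" "sink Q I (functional_rank f) J'"
    "\<And>k. k < length Q \<Longrightarrow> f \<bullet> weight_fun Q J' k = f \<bullet> weight_fun Q J k"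
    by (rule weak_sink_perturb[OF Q J]) blast
  ultimately have "M = J'" using M by (intro sink_unique[OF Q inj_functional_rank])
  then show ?thesis using min[OF K] J'(3)[OF k0] by simp
qed

section \<open>Completing a word\<close>

lemma all_inverted_if_no_ascent:
  fixes w :: "'n::{finite,linorder} \<Rightarrow> 'n"
  assumes w: "bij w" and desc: "\<And>p. p \<in> simple_indices \<Longrightarrow> w (next_index p) < w p"
    and ab: "a < b"
  shows "(a, b) \<in> invs w"
proof -
  define g where "g x = card {y. w x < y}" for x
  have g: "g x < g y" if "w y < w x" for x y
    unfolding g_def using that by (intro psubset_card_mono) (auto dest: less_trans)
  have "strict_mono g"
    by (intro strict_mono_if_next_less g desc)
  have "\<not> inv w a < inv w b"
  proof
    assume "inv w a < inv w b"
    with \<open>strict_mono g\<close> have lt: "g (inv w a) < g (inv w b)" by (rule strict_monoD)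
    have "g (inv w b) < g (inv w a)" using ab by (intro g) (simp add: f_inv[OF w])
    with lt show False by simp
  qed
  moreover have "inv w a \<noteq> inv w b" using ab inv_eq_inv_iff[OF w] by auto
  ultimately show ?thesis using ab by (auto simp: mem_invs not_less le_less)
qed

text \<open>
  Every permutation can be prolonged along ascents to the longest one.
\<close>

lemma ex_completion:
  fixes w :: "'n::{finite,linorder} \<Rightarrow> 'n"
  assumes "bij w"
  shows "\<exists>c. set c \<subseteq> simple_indices \<and>
    card (invs (w \<circ> word_prod c)) = card (invs w) + length c \<and>
    (\<forall>a b. a < b \<longrightarrow> (a, b) \<in> invs (w \<circ> word_prod c))"
  using assms
proof (induction "card (- invs w)" arbitrary: w rule: less_induct)
  case less
  show ?case
  proof (cases "\<exists>p\<in>simple_indices. w p < w (next_index p)")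
    case False
    have "\<forall>a b. a < b \<longrightarrow> (a, b) \<in> invs w"
    proof (intro allI impI, rule all_inverted_if_no_ascent[OF less.prems])
      fix p :: 'n assume p: "p \<in> simple_indices"
      then have "\<not> w p < w (next_index p)" using False by blast
      with image_next_index_neq[OF less.prems p] show "w (next_index p) < w p" by (simp add: not_less le_less)
    qed
    then show ?thesis
      by (intro exI[of _ "[]"] conjI) (simp_all only: word_prod_Nil comp_id list.set list.size empty_subsetI add_0_right)
  next
    case True
    then obtain p where p: "p \<in> simple_indices" "w p < w (next_index p)" by blast
    let ?u = "w \<circ> simple_refl p"
    have "- invs ?u \<subset> - invs w"
      using invs_ascent[OF less.prems p] by blast
    then have "card (- invs ?u) < card (- invs w)" by (intro psubset_card_mono) auto
    from less.hyps[OF this bij_comp_simple_refl[OF less.prems]]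
    obtain c where c: "set c \<subseteq> simple_indices"
      "card (invs (?u \<circ> word_prod c)) = card (invs ?u) + length c"
      "\<forall>a b. a < b \<longrightarrow> (a, b) \<in> invs (?u \<circ> word_prod c)" by (elim exE conjE)
    have eq: "w \<circ> word_prod (p # c) = ?u \<circ> word_prod c"
      unfolding word_prod_Cons by (simp only: comp_assoc)
    show ?thesis
    proof (intro exI[of _ "p # c"] conjI)
      show "set (p # c) \<subseteq> simple_indices" using c(1) p(1) by simp
      show "card (invs (w \<circ> word_prod (p # c))) = card (invs w) + length (p # c)"
        unfolding eq c(2) card_invs_ascent[OF less.prems p] by simp
    qed (unfold eq, rule c(3))
  qed
qed

lemma prefix_prod_append:
  assumes "k \<le> length Q"
  shows "prefix_prod (Q @ c) J k = prefix_prod Q J k"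
proof -
  have "{j. j + length Q \<in> {..<k} - J} = {}" using assms by auto
  then show ?thesis
    unfolding prefix_prod_def nths_append word_prod_append by (simp only: nths_empty word_prod_Nil comp_id)
qed

lemma nth_append_less: "k < length Q \<Longrightarrow> (Q @ c) ! k = Q ! k"
  by (simp add: nth_append)

lemma root_append:
  assumes "k < length Q"
  shows "root_src (Q @ c) J k = root_src Q J k" "root_tgt (Q @ c) J k = root_tgt Q J k"
    "root_fun (Q @ c) J k = root_fun Q J k"
  using prefix_prod_append[OF less_imp_le[OF assms]] nth_append_less[OF assms]
  by (simp_all add: root_src_def root_tgt_def root_fun_eq)

lemma weight_append: "k < length Q \<Longrightarrow> weight_fun (Q @ c) J k = weight_fun Q J k"
  by (simp add: vec_eq_iff weight_fun_nth prefix_prod_append nth_append_less)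

lemma facet_append:
  assumes Q: "set Q \<subseteq> simple_indices" and c: "set c \<subseteq> simple_indices"
    "card (invs (w \<circ> word_prod c)) = card (invs w) + length c"
    and J: "J \<in> sc_facets Q w"
  shows "J \<in> sc_facets (Q @ c) (w \<circ> word_prod c)"
proof -
  have sub: "J \<subseteq> {..<length Q}" by (rule facet_subset[OF Q J])
  have Qc: "set (Q @ c) \<subseteq> simple_indices" using Q c by simp
  let ?X = "{..<length (Q @ c)} - J"
  have 1: "nths Q ?X = nths Q ({..<length Q} - J)"
    by (rule nths_cong_indices) auto
  have 2: "nths c {j. j + length Q \<in> ?X} = c"
    by (rule nths_all) (use sub in auto)
  have "prefix_prod (Q @ c) J (length (Q @ c)) = w \<circ> word_prod c"
    using facet_prefix_prod_length[OF Q J] unfolding prefix_prod_def nths_append 1 2 word_prod_append by (simp only:)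
  moreover have "card ?X = card (invs (w \<circ> word_prod c))"
  proof -
    have "?X = ({..<length Q} - J) \<union> {length Q..<length Q + length c}" using sub by auto
    moreover have "card (({..<length Q} - J) \<union> {length Q..<length Q + length c}) =
        card ({..<length Q} - J) + length c"
      by (subst card_Un_disjoint) auto
    moreover have "card ({..<length Q} - J) = card (invs w)"
      using J unfolding sc_facets_iff_card[OF Q] by blast
    ultimately show ?thesis unfolding c(2) by metis
  qed
  moreover have "J \<subseteq> {..<length (Q @ c)}" using sub by auto
  ultimately show ?thesis
    unfolding sc_facets_iff_card[OF Qc] by blast
qed

lemma weak_sink_append:
  assumes "J \<subseteq> {..<length Q}"
  shows "weak_sink (Q @ c) I f J \<longleftrightarrow> weak_sink Q I f J"
proof -
  have "root_fun (Q @ c) J k = root_fun Q J k" if "k \<in> J - I" for k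
    by (rule root_append(3)) (use that assms in auto)
  then show ?thesis unfolding weak_sink_def by simp
qed

lemma facets_above_append:
  assumes Q: "set Q \<subseteq> simple_indices" and c: "set c \<subseteq> simple_indices"
    "card (invs (w \<circ> word_prod c)) = card (invs w) + length c"
    and J: "J \<in> facets_above Q w I"
  shows "J \<in> facets_above (Q @ c) (w \<circ> word_prod c) I"
  using facet_append[OF Q c] J by (simp add: facets_above_iff)

lemma weak_sink_weight_max:
  assumes Q: "set Q \<subseteq> simple_indices"
    and J: "J \<in> facets_above Q w I" "weak_sink Q I f J" and K: "K \<in> facets_above Q w I"
    and k: "k < length Q"
  shows "f \<bullet> weight_fun Q K k \<le> f \<bullet> weight_fun Q J k"
proof -
  have JF: "J \<in> sc_facets Q w" using J by (simp add: facets_above_iff)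
  have "bij w" using facet_prefix_prod_length[OF Q JF] bij_prefix_prod by metis
  from ex_completion[OF this] obtain c where c: "set c \<subseteq> simple_indices"
    "card (invs (w \<circ> word_prod c)) = card (invs w) + length c"
    "\<forall>a b. a < b \<longrightarrow> (a, b) \<in> invs (w \<circ> word_prod c)" by (elim exE conjE)
  have Qc: "set (Q @ c) \<subseteq> simple_indices" using Q c(1) by simp
  note above = facets_above_append[OF Q c(1,2)]
  have "f \<bullet> weight_fun (Q @ c) K k \<le> f \<bullet> weight_fun (Q @ c) J k"
  proof (rule weak_sink_weight_max_if_all_inverted[OF Qc _ above[OF J(1)] _ above[OF K]])
    show "weak_sink (Q @ c) I f J"
      using J(2) weak_sink_append[OF facet_subset[OF Q JF]] by simp
  qed (use c(3) k in auto)
  then show ?thesis by (simp add: weight_append k)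
qed

text \<open>
  In the prolonged word the position \<open>i\<close> becomes flippable, and its partner \<open>j\<close> lies in the added part.
  There the weights of \<open>J\<close> and \<open>K\<close> agree, since both skip no added letter and have the same
  product before. The flip subtracts the root from the weight of \<open>K\<close> at \<open>j\<close>, and
  optimality of \<open>J\<close> at \<open>j\<close> forbids that this increases \<open>f\<close>.
\<close>

lemma weak_sink_nonflippable_root_nonneg:
  assumes Q: "set Q \<subseteq> simple_indices"
    and J: "J \<in> sc_facets Q w" "weak_sink Q {} f J" and K: "K \<in> sc_facets Q w" and i: "i \<in> K"
    and ab: "root_src Q K i = a" "root_tgt Q K i = b" "a < b" "(a, b) \<notin> invs w"
  shows "0 \<le> f \<bullet> root_fun Q K i"
proof -
  have "bij w" using facet_prefix_prod_length[OF Q K] bij_prefix_prod by metis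
  from ex_completion[OF this] obtain c where c: "set c \<subseteq> simple_indices"
    "card (invs (w \<circ> word_prod c)) = card (invs w) + length c"
    "\<forall>a b. a < b \<longrightarrow> (a, b) \<in> invs (w \<circ> word_prod c)" by (elim exE conjE)
  let ?Q = "Q @ c" and ?w = "w \<circ> word_prod c"
  have Qc: "set ?Q \<subseteq> simple_indices" using Q c(1) by simp
  have im: "i < length Q" using i facet_subset[OF Q K] by auto
  have JQ: "J \<in> facets_above ?Q ?w {}" "weak_sink ?Q {} f J" and KQ: "K \<in> facets_above ?Q ?w {}"
    using facet_append[OF Q c(1,2)] J K weak_sink_append[OF facet_subset[OF Q J(1)]]
    by (simp_all add: facets_above_iff)
  have KF: "K \<in> sc_facets ?Q ?w" using KQ by (simp add: facets_above_iff)
  have pair: "{root_src ?Q K i, root_tgt ?Q K i} = {a, b}" using ab im by (simp add: root_append)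
  have "(a, b) \<in> invs ?w" using c(3) ab(3) by blast
  obtain j d C where j: "j < length ?Q" "j \<notin> K" "root_src ?Q K j = a" "root_tgt ?Q K j = b"
    "insert j (K - {i}) \<in> facets_above ?Q ?w {}"
    and W: "\<And>k. k < length ?Q \<Longrightarrow>
      weight_fun ?Q (insert j (K - {i})) k = weight_fun ?Q K k - d k *\<^sub>R root_fun ?Q K i"
    and d: "d (max i j) = 1" and "(0::real) < C"
    by (rule flip[OF Qc KQ _ pair \<open>(a, b) \<in> invs ?w\<close>]) (use i in blast)+
  have "\<not> j < length Q"
  proof
    assume jm: "j < length Q"
    then have "(root_src Q K j, root_tgt Q K j) \<in> invs w"
      unfolding facet_mem_invs[OF Q K] using j(2) by blast
    then show False using j(3,4) ab(4) jm by (simp add: root_append)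
  qed
  then have jm: "length Q \<le> j" "max i j = j" using im by simp_all
  have prefix_prod_eq: "prefix_prod ?Q J k = prefix_prod ?Q K k" if "length Q \<le> k" "k \<le> length ?Q" for k
    using that
  proof (induction k rule: dec_induct)
    case base
    show ?case
      by (simp only: prefix_prod_append order_refl facet_prefix_prod_length[OF Q J(1)] facet_prefix_prod_length[OF Q K])
  next
    case (step k)
    then have k: "k < length ?Q" by simp
    have "k \<notin> J" "k \<notin> K" using step facet_subset[OF Q J(1)] facet_subset[OF Q K] by auto
    moreover have "prefix_prod ?Q J k = prefix_prod ?Q K k" using step.IH k by simp
    ultimately show ?case by (simp only: prefix_prod_Suc_notin[OF k] not_False_eq_True)
  qed
  have "weight_fun ?Q J j = weight_fun ?Q K j"
    using prefix_prod_eq[of j] jm j(1) by (simp add: vec_eq_iff weight_fun_nth)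
  moreover have "f \<bullet> weight_fun ?Q (insert j (K - {i})) j \<le> f \<bullet> weight_fun ?Q J j"
    by (rule weak_sink_weight_max[OF Qc JQ j(5,1)])
  moreover have "weight_fun ?Q (insert j (K - {i})) j = weight_fun ?Q K j - root_fun ?Q K i"
    using W[OF j(1)] d jm(2) by simp
  ultimately show ?thesis
    using im by (simp add: root_append inner_diff_right)
qed

section \<open>Bruhat order and the Demazure product\<close>

text \<open>
  Strong exchange: if \<open>(a, b)\<close> is an inversion, it is the root of some letter of a reduced word, and
  deleting that letter multiplies by the transposition.
\<close>

lemma invs_swp_iff_shorter:
  fixes w :: "'n::{finite,linorder} \<Rightarrow> 'n"
  assumes w: "bij w" and ab: "a < b"
  shows "card (invs (swp a b \<circ> w)) < card (invs w) \<longleftrightarrow> (a, b) \<in> invs w"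
    and "card (invs w) < card (invs (swp a b \<circ> w)) \<longleftrightarrow> (a, b) \<notin> invs w"
proof -
  have shorter: "card (invs (swp a b \<circ> u)) < card (invs u)" if u: "bij u" "(a, b) \<in> invs u"
    for u :: "'n \<Rightarrow> 'n"
  proof -
    obtain Q where Q: "set Q \<subseteq> simple_indices" "length Q = card (invs u)" "word_prod Q = u"
      by (rule ex_word_of_card_invs[OF u(1)])
    have "nths Q {..<length Q} = Q" by (rule nths_all) simp
    then have "prefix_prod Q {} (length Q) = u" using Q(3) by (simp add: prefix_prod_def)
    then have F: "{} \<in> sc_facets Q u"
      unfolding sc_facets_iff_card[OF Q(1)] using Q(2) by simp
    from facet_mem_invs[OF Q(1) F, THEN iffD1, OF u(2)]
    obtain i where i: "i < length Q" "root_src Q {} i = a" "root_tgt Q {} i = b"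
      unfolding prod.inject by (elim exE conjE) simp
    have "prefix_prod Q {i} (length Q) = swp a b \<circ> u"
      using prefix_prod_insert[of i "{}" Q "length Q"] i \<open>prefix_prod Q {} (length Q) = u\<close> by simp
    then have "card (invs (swp a b \<circ> u)) \<le> card ({..<length Q} - {i})"
      using card_invs_prefix_prod(1)[OF Q(1) order_refl, of "{i}"] by simp
    also have "\<dots> < length Q" using i(1) by simp
    finally show ?thesis using Q(2) by simp
  qed
  have cancel: "swp a b \<circ> (swp a b \<circ> w) = w" by (simp flip: comp_assoc)
  have longer: "card (invs w) < card (invs (swp a b \<circ> w))" if "(a, b) \<notin> invs w"
  proof -
    have "(a, b) \<in> invs (swp a b \<circ> w)" using that invs_swp_comp_iff[OF w ab] by blast
    from shorter[OF bij_swp_comp[OF w] this] show ?thesis unfolding cancel .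
  qed
  show "card (invs (swp a b \<circ> w)) < card (invs w) \<longleftrightarrow> (a, b) \<in> invs w"
    using shorter[OF w] longer by (metis less_asym)
  show "card (invs w) < card (invs (swp a b \<circ> w)) \<longleftrightarrow> (a, b) \<notin> invs w"
    using shorter[OF w] longer by (metis less_asym)
qed

lemma bruhat_step_iff:
  assumes "bij u"
  shows "bruhat_step u v \<longleftrightarrow> (\<exists>a b. a < b \<and> v = swp a b \<circ> u \<and> (a, b) \<notin> invs u)"
proof
  assume "bruhat_step u v"
  then obtain x y where xy: "x \<noteq> y" "v = swp x y \<circ> u" and len: "cox_length u < cox_length v"
    by (auto simp: bruhat_step_def roots_def root_refl_eq)
  let ?a = "min x y" and ?b = "max x y"
  have ab: "?a < ?b" "swp x y = swp ?a ?b"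
    using xy(1) by (auto simp: min_def max_def transpose_commute)
  have "bij v" using xy assms by simp
  then have "card (invs u) < card (invs (swp ?a ?b \<circ> u))"
    using len assms xy(2) ab(2) by (simp add: cox_length_eq_card_invs)
  then have "(?a, ?b) \<notin> invs u" using invs_swp_iff_shorter(2)[OF assms ab(1)] by simp
  then show "\<exists>a b. a < b \<and> v = swp a b \<circ> u \<and> (a, b) \<notin> invs u"
    using ab xy(2) by (intro exI[of _ ?a] exI[of _ ?b]) simp
next
  assume "\<exists>a b. a < b \<and> v = swp a b \<circ> u \<and> (a, b) \<notin> invs u"
  then obtain a b where ab: "a < b" "v = swp a b \<circ> u" "(a, b) \<notin> invs u" by blast
  then have "cox_length u < cox_length v"
    using invs_swp_iff_shorter(2)[OF assms ab(1)] assms by (simp add: cox_length_eq_card_invs)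
  moreover have "std_basis a - std_basis b \<in> roots" "root_refl (std_basis a - std_basis b) = swp a b"
    using ab(1) by (auto simp: roots_def root_refl_eq)
  ultimately show "bruhat_step u v" using ab(2) unfolding bruhat_step_def by metis
qed

lemma bruhat_le_length:
  assumes "u \<le>\<^sub>B v"
  shows "u = v \<or> cox_length u < cox_length v"
  using assms unfolding bruhat_le_def
  by (induction rule: rtranclp_induct) (auto simp: bruhat_step_def)

lemma bruhat_le_refl [simp]: "u \<le>\<^sub>B u"
  by (simp add: bruhat_le_def)

lemma bruhat_le_trans: "u \<le>\<^sub>B v \<Longrightarrow> v \<le>\<^sub>B x \<Longrightarrow> u \<le>\<^sub>B x"
  unfolding bruhat_le_def by (rule rtranclp_trans)

lemma bruhat_step_le: "bruhat_step u v \<Longrightarrow> u \<le>\<^sub>B v"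
  by (auto simp: bruhat_le_def)

lemma bruhat_le_antisym: "u \<le>\<^sub>B v \<Longrightarrow> v \<le>\<^sub>B u \<Longrightarrow> u = v"
  using bruhat_le_length[of u v] bruhat_le_length[of v u] by auto

lemma bruhat_le_swp: "bij u \<Longrightarrow> a < b \<Longrightarrow> (a, b) \<notin> invs u \<Longrightarrow> u \<le>\<^sub>B swp a b \<circ> u"
  by (intro bruhat_step_le) (auto simp: bruhat_step_iff)

lemma bruhat_le_ascent:
  assumes "bij u" "p \<in> simple_indices" "u p < u (next_index p)"
  shows "u \<le>\<^sub>B u \<circ> simple_refl p"
  unfolding simple_comp_eq_swp_comp[OF assms(1)]
  using assms invs_ascent(2)[OF assms] by (intro bruhat_le_swp)

lemma bruhat_le_simple_cases:
  assumes "bij u" "p \<in> simple_indices"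
  shows "u \<le>\<^sub>B u \<circ> simple_refl p \<or> u \<circ> simple_refl p \<le>\<^sub>B u"
  using image_next_index_neq[OF assms]
proof (rule linorder_neqE)
  assume "u (next_index p) < u p"
  then have "u \<circ> simple_refl p \<le>\<^sub>B (u \<circ> simple_refl p) \<circ> simple_refl p"
    using assms by (intro bruhat_le_ascent) simp_all
  then have "u \<circ> simple_refl p \<le>\<^sub>B u" by (simp only: comp_assoc simple_refl_involutory comp_id)
  then show ?thesis by (rule disjI2)
qed (use bruhat_le_ascent[OF assms] in blast)

text \<open>
  The lifting property. A single Bruhat step remains one after right multiplication by a simple
  reflection, unless the step itself is the multiplication by that reflection.
\<close>

lemma bruhat_le_simple_lift:
  assumes "u \<le>\<^sub>B v" "bij u" "p \<in> simple_indices"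
  shows "u \<circ> simple_refl p \<le>\<^sub>B v \<or> u \<circ> simple_refl p \<le>\<^sub>B v \<circ> simple_refl p"
  using assms(1,2) unfolding bruhat_le_def[of u v]
proof (induction rule: converse_rtranclp_induct)
  case base
  show ?case by simp
next
  case (step u u')
  obtain a b where ab: "a < b" "u' = swp a b \<circ> u" "(a, b) \<notin> invs u"
    using step.hyps(1) bruhat_step_iff[OF step.prems] by blast
  have "bij u'" using ab(2) step.prems by simp
  have u'v: "u' \<le>\<^sub>B v" using step.hyps(2) by (simp add: bruhat_le_def)
  have bij: "bij (u \<circ> simple_refl p)" using step.prems by simp
  show ?case
  proof (cases "(a, b) \<in> invs (u \<circ> simple_refl p)")
    case False
    have "u \<circ> simple_refl p \<le>\<^sub>B swp a b \<circ> (u \<circ> simple_refl p)"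
      by (rule bruhat_le_swp[OF bij ab(1) False])
    also have "swp a b \<circ> (u \<circ> simple_refl p) = u' \<circ> simple_refl p"
      unfolding ab(2) by (simp only: comp_assoc)
    finally have "u \<circ> simple_refl p \<le>\<^sub>B u' \<circ> simple_refl p" .
    then show ?thesis using step.IH[OF \<open>bij u'\<close>] bruhat_le_trans by blast
  next
    case True
    \<comment> \<open>Only the pair that the simple reflection exchanges changes its status.\<close>
    have "(u p, u (next_index p)) = (a, b)"
    proof (cases "u p < u (next_index p)")
      case asc: True
      then show ?thesis
        using True ab(3) invs_ascent(1)[OF step.prems assms(3) asc] by auto
    next
      case False
      then have "u (next_index p) < u p"
        using image_next_index_neq[OF step.prems assms(3)] by (simp add: not_less le_less)
      then show ?thesis
        using True ab(3) invs_descent(1)[OF step.prems assms(3)] by auto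
    qed
    then have "u \<circ> simple_refl p = u'"
      unfolding ab(2) simple_comp_eq_swp_comp[OF step.prems] by simp
    then show ?thesis using u'v by simp
  qed
qed

definition sub_prods :: "'n::{finite,linorder} list \<Rightarrow> ('n \<Rightarrow> 'n) set"
  where "sub_prods Q = {word_prod (nths Q X) | X. X \<subseteq> {..<length Q}}"

lemma mem_sub_prods: "u \<in> sub_prods Q \<longleftrightarrow> (\<exists>J\<subseteq>{..<length Q}. prefix_prod Q J (length Q) = u)"
proof
  assume "u \<in> sub_prods Q"
  then obtain X where X: "X \<subseteq> {..<length Q}" "u = word_prod (nths Q X)" by (auto simp: sub_prods_def)
  then have "{..<length Q} - ({..<length Q} - X) = X" by auto
  then have "prefix_prod Q ({..<length Q} - X) (length Q) = u" using X(2) by (simp add: prefix_prod_def)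
  then show "\<exists>J\<subseteq>{..<length Q}. prefix_prod Q J (length Q) = u" by (intro exI[of _ "{..<length Q} - X"]) auto
qed (auto simp: sub_prods_def prefix_prod_def)

lemma bij_sub_prods: "u \<in> sub_prods Q \<Longrightarrow> bij u"
  by (auto simp: sub_prods_def)

lemma prefix_prod_in_sub_prods: "prefix_prod Q J (length Q) \<in> sub_prods Q"
  unfolding sub_prods_def prefix_prod_def by blast

lemma sub_prods_snoc:
  "sub_prods (Q @ [p]) = sub_prods Q \<union> (\<lambda>u. u \<circ> simple_refl p) ` sub_prods Q"
proof -
  have k: "length Q < length (Q @ [p])" "(Q @ [p]) ! length Q = p" by simp_all
  have last: "prefix_prod (Q @ [p]) J (length (Q @ [p])) =
    (if length Q \<in> J then prefix_prod Q J (length Q) else prefix_prod Q J (length Q) \<circ> simple_refl p)" for J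
    using prefix_prod_Suc_mem[OF k(1), of J] prefix_prod_Suc_notin[OF k(1), of J]
    unfolding k(2) prefix_prod_append[OF order_refl] length_append_singleton by (simp only: if_split) blast
  show ?thesis
  proof (intro equalityI subsetI)
    fix u assume "u \<in> sub_prods (Q @ [p])"
    then obtain J where "prefix_prod (Q @ [p]) J (length (Q @ [p])) = u" unfolding mem_sub_prods by blast
    then show "u \<in> sub_prods Q \<union> (\<lambda>u. u \<circ> simple_refl p) ` sub_prods Q"
      using prefix_prod_in_sub_prods[of Q J] unfolding last by (auto split: if_splits)
  next
    fix u assume "u \<in> sub_prods Q \<union> (\<lambda>u. u \<circ> simple_refl p) ` sub_prods Q"
    then obtain v where v: "v \<in> sub_prods Q" "u = v \<or> u = v \<circ> simple_refl p" by blast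
    then obtain J where J: "J \<subseteq> {..<length Q}" "prefix_prod Q J (length Q) = v" unfolding mem_sub_prods by blast
    have "prefix_prod Q (insert (length Q) J) (length Q) = v"
      unfolding J(2)[symmetric] by (rule prefix_prod_cong) simp
    then have "prefix_prod (Q @ [p]) (insert (length Q) J) (length (Q @ [p])) = v"
      "prefix_prod (Q @ [p]) J (length (Q @ [p])) = v \<circ> simple_refl p"
      unfolding last using J by auto
    then show "u \<in> sub_prods (Q @ [p])"
      using v(2) prefix_prod_in_sub_prods[of "Q @ [p]"] by metis
  qed
qed

text \<open>
  Appending a letter \<open>p\<close> to the word replaces the maximum \<open>d\<close> by the larger one of \<open>d\<close> and
  \<open>d \<circ> simple_refl p\<close>; this is where lifting is used.
\<close>

lemma ex_bruhat_max:
  "set Q \<subseteq> simple_indices \<Longrightarrow> \<exists>d\<in>sub_prods Q. \<forall>u\<in>sub_prods Q. u \<le>\<^sub>B d"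
proof (induction Q rule: rev_induct)
  case Nil
  have "sub_prods ([] :: 'a list) = {id}" unfolding sub_prods_def nths_nil word_prod_Nil by auto
  then show ?case by simp
next
  case (snoc p Q)
  then obtain d where d: "d \<in> sub_prods Q" "\<And>u. u \<in> sub_prods Q \<Longrightarrow> u \<le>\<^sub>B d" by auto
  have p: "p \<in> simple_indices" using snoc.prems by simp
  let ?e = "d \<circ> simple_refl p"
  have up: "u \<le>\<^sub>B d" "u \<circ> simple_refl p \<le>\<^sub>B d \<or> u \<circ> simple_refl p \<le>\<^sub>B ?e"
    if "u \<in> sub_prods Q" for u
    using d(2)[OF that] bruhat_le_simple_lift[OF _ bij_sub_prods[OF that] p] by blast+
  have mem: "d \<in> sub_prods (Q @ [p])" "?e \<in> sub_prods (Q @ [p])"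
    unfolding sub_prods_snoc using d(1) by blast+
  from bruhat_le_simple_cases[OF bij_sub_prods[OF d(1)] p] show ?case
  proof
    assume "d \<le>\<^sub>B ?e"
    then have "u \<le>\<^sub>B ?e" if "u \<in> sub_prods (Q @ [p])" for u
      using that up bruhat_le_trans unfolding sub_prods_snoc by blast
    then show ?thesis using mem(2) by blast
  next
    assume "?e \<le>\<^sub>B d"
    then have "u \<le>\<^sub>B d" if "u \<in> sub_prods (Q @ [p])" for u
      using that up bruhat_le_trans unfolding sub_prods_snoc by blast
    then show ?thesis using mem(1) by blast
  qed
qed

lemma Dem_max:
  assumes "set Q \<subseteq> simple_indices"
  shows "Dem Q \<in> sub_prods Q" and "u \<in> sub_prods Q \<Longrightarrow> u \<le>\<^sub>B Dem Q"
proof -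
  obtain d where d: "d \<in> sub_prods Q" "\<forall>u\<in>sub_prods Q. u \<le>\<^sub>B d" using ex_bruhat_max[OF assms] by blast
  have "Dem Q = (THE u. u \<in> sub_prods Q \<and> (\<forall>v\<in>sub_prods Q. v \<le>\<^sub>B u))"
    unfolding Dem_def Let_def sub_prods_def ..
  also have "\<dots> = d" using d bruhat_le_antisym by (intro the_equality) blast+
  finally show "Dem Q \<in> sub_prods Q" and "u \<in> sub_prods Q \<Longrightarrow> u \<le>\<^sub>B Dem Q" using d by auto
qed

section \<open>Bruhat covers and root functions\<close>

text \<open>
  A shortest subword with product \<open>u\<close> is reduced: the first letter with a negative root cancels
  against the earlier letter that inverted its pair.
\<close>

lemma sc_facets_nonempty_if_sub_prod:
  assumes Q: "set Q \<subseteq> simple_indices" and u: "u \<in> sub_prods Q"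
  shows "\<exists>J. J \<in> sc_facets Q u"
proof -
  let ?m = "length Q"
  let ?P = "\<lambda>J. J \<subseteq> {..<?m} \<and> prefix_prod Q J ?m = u" and ?N = "\<lambda>J. card ({..<?m} - J)"
  from u obtain J0 where "?P J0" unfolding mem_sub_prods by blast
  from ex_has_least_nat[of ?P, OF this, of ?N]
  obtain J where J: "J \<subseteq> {..<?m}" "prefix_prod Q J ?m = u"
    and min: "\<And>K. K \<subseteq> {..<?m} \<Longrightarrow> prefix_prod Q K ?m = u \<Longrightarrow> ?N J \<le> ?N K" by blast
  have "root_src Q J k < root_tgt Q J k" if "k < ?m" "k \<notin> J" for k
  proof (rule ccontr)
    let ?bad = "\<lambda>k. k < ?m \<and> k \<notin> J \<and> \<not> root_src Q J k < root_tgt Q J k"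
    assume "\<not> ?thesis"
    with that have "?bad k" by blast
    define l where "l = (LEAST k. ?bad k)"
    have l: "l < ?m" "l \<notin> J" "\<not> root_src Q J l < root_tgt Q J l"
      using LeastI[of ?bad, OF \<open>?bad k\<close>] unfolding l_def by blast+
    have pos: "root_src Q J i < root_tgt Q J i" if "i < l" "i \<notin> J" for i
      using not_less_Least[of i ?bad] that l(1) unfolding l_def by auto
    have "root_tgt Q J l < root_src Q J l"
      using l(3) root_src_neq_tgt[OF Q l(1), of J] by (simp add: not_less le_less)
    from mem_invs_prefix_prod[OF Q less_imp_le[OF l(1)] pos, THEN iffD1, OF _ _ root_reversed_in_invs_prefix_prod[OF Q l(1) this]]
    obtain i where i: "i < l" "i \<notin> J" "root_tgt Q J l = root_src Q J i" "root_src Q J l = root_tgt Q J i"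
      unfolding prod.inject by blast
    let ?J1 = "insert l J"
    have im: "i < ?m" and iJ1: "i \<notin> ?J1" using i l(1) by auto
    have pre1: "prefix_prod Q ?J1 ?m = swp (root_src Q J l) (root_tgt Q J l) \<circ> u"
      using prefix_prod_insert[OF l(2,1) order_refl] l(1) J(2) by simp
    have "prefix_prod Q ?J1 i = prefix_prod Q J i" by (rule prefix_prod_cong) (use i(1) in auto)
    then have "root_src Q ?J1 i = root_src Q J i" "root_tgt Q ?J1 i = root_tgt Q J i"
      by (simp_all add: root_src_def root_tgt_def)
    then have "prefix_prod Q (insert i ?J1) ?m = swp (root_src Q J i) (root_tgt Q J i) \<circ> prefix_prod Q ?J1 ?m"
      using prefix_prod_insert[OF iJ1 im order_refl] im by simp
    also have "\<dots> = u"
      unfolding pre1 i(3,4) by (simp add: transpose_commute[of "root_tgt Q J i"] flip: comp_assoc)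
    finally have "?N J \<le> ?N (insert i ?J1)" using J(1) im l(1) by (intro min) auto
    moreover have "{..<?m} - insert i ?J1 \<subset> {..<?m} - J" using im i(2) by auto
    then have "?N (insert i ?J1) < ?N J" by (intro psubset_card_mono) auto
    ultimately show False by simp
  qed
  then show ?thesis using J unfolding sc_facets_iff[OF Q] by blast
qed

lemma sub_prods_downward_closed:
  assumes Q: "set Q \<subseteq> simple_indices" and "u \<le>\<^sub>B v" "bij u" "v \<in> sub_prods Q"
  shows "u \<in> sub_prods Q"
  using assms(2,3) unfolding bruhat_le_def
proof (induction rule: converse_rtranclp_induct)
  case base
  show ?case by (rule assms(4))
next
  case (step u v)
  obtain a b where ab: "a < b" "v = swp a b \<circ> u" "(a, b) \<notin> invs u"
    using step.hyps(1) bruhat_step_iff[OF step.prems] by blast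
  have "bij v" using ab(2) step.prems by simp
  then have "v \<in> sub_prods Q" by (rule step.IH)
  from sc_facets_nonempty_if_sub_prod[OF Q this] obtain J where J: "J \<in> sc_facets Q v" by blast
  have "(a, b) \<in> invs v" using ab invs_swp_comp_iff[OF step.prems ab(1)] by blast
  from facet_mem_invs[OF Q J, THEN iffD1, OF this]
  obtain i where i: "i < length Q" "i \<notin> J" "root_src Q J i = a" "root_tgt Q J i = b"
    unfolding prod.inject by (elim exE conjE) simp
  have "prefix_prod Q (insert i J) (length Q) = swp a b \<circ> v"
    using prefix_prod_insert[OF i(2,1) order_refl] i facet_prefix_prod_length[OF Q J] by simp
  also have "\<dots> = u" unfolding ab(2) by (simp flip: comp_assoc)
  finally show ?case using prefix_prod_in_sub_prods[of Q "insert i J"] by simp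
qed

definition bruhat_generators :: "'n::{finite,linorder} list \<Rightarrow> ('n \<Rightarrow> 'n) \<Rightarrow> (real, 'n) vec set"
  where "bruhat_generators Q w =
    {\<beta> \<in> pos_roots. w \<prec>\<^sub>B root_refl \<beta> \<circ> w \<and> root_refl \<beta> \<circ> w \<le>\<^sub>B Dem Q}"

lemma finite_bruhat_generators: "finite (bruhat_generators Q w)"
proof (rule finite_subset)
  show "bruhat_generators Q w \<subseteq> (\<lambda>(i, j). std_basis i - std_basis j) ` UNIV"
    by (auto simp: bruhat_generators_def pos_roots_def)
qed simp

text \<open>
  Using the skipped letter \<open>i\<close> as well gives a subword with product \<open>swp a b \<circ> w\<close> and only one letter
  more than the length of \<open>w\<close>. So this product covers \<open>w\<close> and is below the Demazure product.
\<close>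

lemma nonflippable_root_generator:
  assumes Q: "set Q \<subseteq> simple_indices" and J: "J \<in> sc_facets Q w" and i: "i \<in> J"
    and ab: "root_src Q J i = a" "root_tgt Q J i = b" "a < b" "(a, b) \<notin> invs w"
  shows "root_fun Q J i \<in> bruhat_generators Q w"
proof -
  let ?u = "swp a b \<circ> w" and ?m = "length Q"
  have im: "i < ?m" using i facet_subset[OF Q J] by auto
  have w: "bij w" using facet_prefix_prod_length[OF Q J] bij_prefix_prod by metis
  have u: "prefix_prod Q (J - {i}) ?m = ?u"
    using prefix_prod_remove[OF i im order_refl] im facet_prefix_prod_length[OF Q J] ab by simp
  then have "?u \<le>\<^sub>B Dem Q" using Dem_max(2)[OF Q] prefix_prod_in_sub_prods[of Q "J - {i}"] by simp
  have "card (invs ?u) \<le> card ({..<?m} - (J - {i}))"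
    using card_invs_prefix_prod(1)[OF Q order_refl, of "J - {i}"] u by simp
  also have "{..<?m} - (J - {i}) = insert i ({..<?m} - J)" using im by auto
  then have "card ({..<?m} - (J - {i})) = Suc (card ({..<?m} - J))" using i by simp
  also have "card ({..<?m} - J) = card (invs w)" using J unfolding sc_facets_iff_card[OF Q] by blast
  finally have len: "cox_length ?u \<le> Suc (cox_length w)"
    unfolding cox_length_eq_card_invs[OF w] cox_length_eq_card_invs[OF bij_swp_comp[OF w]] .
  have le: "w \<le>\<^sub>B ?u" by (rule bruhat_le_swp[OF w ab(3,4)])
  have "w \<noteq> ?u" using invs_swp_comp_iff[OF w ab(3)] by metis
  have "x = w \<or> x = ?u" if "w \<le>\<^sub>B x" "x \<le>\<^sub>B ?u" for x
    using bruhat_le_length[OF that(1)] bruhat_le_length[OF that(2)] len by auto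
  then have "w \<prec>\<^sub>B ?u" using le \<open>w \<noteq> ?u\<close> unfolding bruhat_cover_def by blast
  moreover have "root_refl (root_fun Q J i) = swp a b"
    using ab(3) by (simp add: root_fun_eq ab(1,2) root_refl_eq)
  moreover have "root_fun Q J i \<in> pos_roots"
    using ab by (auto simp: root_fun_eq pos_roots_def)
  ultimately show ?thesis using \<open>?u \<le>\<^sub>B Dem Q\<close> by (simp add: bruhat_generators_def)
qed

text \<open>
  A value \<open>c\<close> between \<open>a\<close> and \<open>b\<close> whose place is between theirs allows three upward steps, exchanging
  \<open>a, c\<close>, then \<open>c, b\<close>, then \<open>a, c\<close> again, instead of one.
\<close>

lemma not_cover_if_intermediate:
  assumes w: "bij w" and ac: "a < c" "c < b" and pos: "inv w a < inv w c" "inv w c < inv w b"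
  shows "\<not> w \<prec>\<^sub>B swp a b \<circ> w"
proof
  assume cover: "w \<prec>\<^sub>B swp a b \<circ> w"
  let ?x = "swp a c \<circ> w" and ?y = "swp c b \<circ> (swp a c \<circ> w)"
  have ne: "a \<noteq> c" "c \<noteq> b" "a \<noteq> b" using ac by auto
  have bij: "bij ?x" "bij ?y" using w by simp_all
  have "(a, c) \<notin> invs w" using pos by (auto simp: mem_invs dest: less_asym)
  then have 1: "w \<le>\<^sub>B ?x" using w ac by (intro bruhat_le_swp)
  have "(c, b) \<notin> invs ?x"
    using pos ne by (simp add: mem_invs inv_swp_comp[OF w] not_less less_imp_le)
  then have 2: "?x \<le>\<^sub>B ?y" using bij ac by (intro bruhat_le_swp)
  have "(a, c) \<notin> invs ?y"
    using pos ne by (simp add: mem_invs inv_swp_comp[OF w] inv_swp_comp[OF bij(1)] not_less less_imp_le)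
  then have 3: "?y \<le>\<^sub>B swp a c \<circ> ?y" using bij ac by (intro bruhat_le_swp)
  have "swp a c \<circ> ?y = swp a b \<circ> w"
    using ne by (auto simp: fun_eq_iff Transposition.transpose_def)
  then have "?x \<le>\<^sub>B swp a b \<circ> w" using 2 3 bruhat_le_trans by metis
  moreover have "?x \<in> sym_group" using bij by (simp add: sym_group_iff)
  ultimately have "?x = w \<or> ?x = swp a b \<circ> w"
    using cover 1 unfolding bruhat_cover_def by blast
  moreover have "inv ?x a = inv w c" "inv ?x b = inv w b" "inv (swp a b \<circ> w) b = inv w a"
    using ne by (simp_all add: inv_swp_comp[OF w])
  ultimately show False using pos by auto
qed

text \<open>
  Take a reduced subword for the cover and skip the letter that inverts \<open>(a, b)\<close>. What remains is a
  subword for \<open>w\<close>. If it were not reduced, one of its later letters would exhibit a value between \<open>a\<close>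
  and \<open>b\<close> in an intermediate place, and there would be no cover.
\<close>

lemma bruhat_generator_is_root:
  assumes Q: "set Q \<subseteq> simple_indices" and w: "bij w" and \<beta>: "\<beta> \<in> bruhat_generators Q w"
  obtains K i where "K \<in> sc_facets Q w" "i \<in> K" "\<beta> = root_fun Q K i"
    "root_src Q K i < root_tgt Q K i" "(root_src Q K i, root_tgt Q K i) \<notin> invs w"
proof -
  from \<beta> obtain a b where ab: "a < b" "\<beta> = std_basis a - std_basis b"
    by (auto simp: bruhat_generators_def pos_roots_def)
  let ?u = "swp a b \<circ> w" and ?m = "length Q"
  have "root_refl \<beta> = swp a b" using ab by (simp add: root_refl_eq)
  then have cover: "w \<prec>\<^sub>B ?u" and "?u \<le>\<^sub>B Dem Q" using \<beta> by (simp_all add: bruhat_generators_def)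
  have u: "bij ?u" using w by simp
  have "?u \<in> sub_prods Q"
    by (rule sub_prods_downward_closed[OF Q \<open>?u \<le>\<^sub>B Dem Q\<close> u Dem_max(1)[OF Q]])
  from sc_facets_nonempty_if_sub_prod[OF Q this] obtain J where J: "J \<in> sc_facets Q ?u" by blast
  have "cox_length w < cox_length ?u"
    using cover bruhat_le_length[of w ?u] unfolding bruhat_cover_def by blast
  then have notin: "(a, b) \<notin> invs w"
    using invs_swp_iff_shorter(2)[OF w ab(1)] w by (simp add: cox_length_eq_card_invs)
  then have "(a, b) \<in> invs ?u" using invs_swp_comp_iff[OF w ab(1)] by blast
  from facet_mem_invs[OF Q J, THEN iffD1, OF this]
  obtain i where i: "i < ?m" "i \<notin> J" "root_src Q J i = a" "root_tgt Q J i = b"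
    unfolding prod.inject by (elim exE conjE) simp
  let ?K = "insert i J"
  have prefix_prod_K: "prefix_prod Q ?K k = (if k \<le> i then prefix_prod Q J k else swp a b \<circ> prefix_prod Q J k)" if "k \<le> ?m" for k
    using prefix_prod_insert[OF i(2,1) that] unfolding i(3,4) .
  have root_K: "root_src Q ?K k = (if k \<le> i then root_src Q J k else swp a b (root_src Q J k))"
    "root_tgt Q ?K k = (if k \<le> i then root_tgt Q J k else swp a b (root_tgt Q J k))" if "k < ?m" for k
    using prefix_prod_K[OF less_imp_le[OF that]] by (simp_all add: root_src_def root_tgt_def)
  have K_prefix_prod: "prefix_prod Q ?K ?m = w"
    using prefix_prod_K[OF order_refl] i(1) facet_prefix_prod_length[OF Q J] by (simp flip: comp_assoc)
  have between: False if c: "a < c" "c < b" and inv: "(a, c) \<in> invs ?u" "(c, b) \<in> invs ?u" for c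
  proof -
    have "inv ?u b < inv ?u c" "inv ?u c < inv ?u a" using inv by (simp_all add: mem_invs)
    moreover have "inv ?u a = inv w b" "inv ?u b = inv w a" "inv ?u c = inv w c"
      using c by (simp_all add: inv_swp_comp[OF w])
    ultimately show False using not_cover_if_intermediate[OF w c] cover by simp
  qed
  have pi: "inv (prefix_prod Q J i) a = Q ! i" "inv (prefix_prod Q J i) b = next_index (Q ! i)"
    using inv_prefix_prod_root_src[of Q J i] inv_prefix_prod_root_tgt[of Q J i] unfolding i(3,4) .
  have sub: "invs (prefix_prod Q J i) \<subseteq> invs ?u" using facet_invs_prefix_prod_subset[OF Q J] i(1) by simp
  \<comment> \<open>Position \<open>i\<close> makes \<open>a\<close> and \<open>b\<close> neighbours, so a later root that shares an index with
    them locates a value strictly between \<open>a\<close> and \<open>b\<close>.\<close>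
  have "root_src Q ?K k < root_tgt Q ?K k" if k: "k < ?m" "k \<notin> ?K" for k
  proof (rule ccontr)
    assume not: "\<not> ?thesis"
    let ?x = "root_src Q J k" and ?y = "root_tgt Q J k"
    have kJ: "k \<notin> J" "k \<noteq> i" using k by auto
    have xy: "?x < ?y" by (rule facet_root_pos[OF Q J k(1) kJ(1)])
    then have ik: "i < k" using not root_K[OF k(1)] by (cases "k \<le> i") auto
    have swapped: "\<not> swp a b ?x < swp a b ?y" using not root_K[OF k(1)] ik by simp
    have iff: "(?x, ?y) \<in> invs (prefix_prod Q J l) \<longleftrightarrow> k < l" if "l \<le> ?m" for l
      using facet_root_in_invs_prefix_prod_iff[OF Q J k(1) kJ(1) that] .
    have u_xy: "(?x, ?y) \<in> invs ?u" using facet_mem_invs[OF Q J] k(1) kJ(1) by blast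
    have notin_i: "(?x, ?y) \<notin> invs (prefix_prod Q J i)" using iff[of i] ik i(1) by simp
    have "(?x, ?y) \<noteq> (a, b)"
      using facet_root_in_invs_prefix_prod_iff[OF Q J i(1,2), of k] iff[of k] i ik k(1) by auto
    then have "(?x = a \<and> ?y < b) \<or> (?y = b \<and> a < ?x)"
      using xy swapped ab(1) by (auto simp: Transposition.transpose_def not_less split: if_splits)
    then show False
    proof
      assume y: "?x = a \<and> ?y < b"
      have "inv (prefix_prod Q J i) ?y \<noteq> inv (prefix_prod Q J i) a" "inv (prefix_prod Q J i) ?y \<noteq> inv (prefix_prod Q J i) b"
        using xy y inv_eq_inv_iff[OF bij_prefix_prod, of Q J i] by auto
      moreover have "\<not> inv (prefix_prod Q J i) ?y < inv (prefix_prod Q J i) a" using notin_i xy y by (simp add: mem_invs)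
      ultimately have "inv (prefix_prod Q J i) b < inv (prefix_prod Q J i) ?y"
        using next_index_le[of "Q ! i" "inv (prefix_prod Q J i) ?y"] unfolding pi by (auto simp: not_less le_less)
      then have "(?y, b) \<in> invs (prefix_prod Q J i)" using y by (simp add: mem_invs)
      then show False using between[of ?y] xy y u_xy sub by auto
    next
      assume x: "?y = b \<and> a < ?x"
      have "inv (prefix_prod Q J i) ?x \<noteq> inv (prefix_prod Q J i) a" "inv (prefix_prod Q J i) ?x \<noteq> inv (prefix_prod Q J i) b"
        using xy x inv_eq_inv_iff[OF bij_prefix_prod, of Q J i] by auto
      moreover have "\<not> inv (prefix_prod Q J i) b < inv (prefix_prod Q J i) ?x" using notin_i xy x by (simp add: mem_invs)
      ultimately have "inv (prefix_prod Q J i) ?x < inv (prefix_prod Q J i) a"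
        using next_index_le[of "Q ! i" "inv (prefix_prod Q J i) ?x"] unfolding pi
        by (metis linorder_neqE not_less)
      then have "(a, ?x) \<in> invs (prefix_prod Q J i)" using x by (simp add: mem_invs)
      then show False using between[of ?x] xy x u_xy sub by auto
    qed
  qed
  then have K: "?K \<in> sc_facets Q w"
    unfolding sc_facets_iff[OF Q] using facet_subset[OF Q J] i(1) K_prefix_prod by auto
  have Ki: "root_src Q ?K i = a" "root_tgt Q ?K i = b" using root_K[OF i(1)] i(3,4) by simp_all
  show ?thesis
    by (rule that[OF K, of i]) (use ab notin in \<open>simp_all add: Ki root_fun_eq\<close>)
qed

lemma weak_sink_generator_nonneg:
  assumes Q: "set Q \<subseteq> simple_indices" and J: "J \<in> sc_facets Q w" "weak_sink Q {} f J"
    and \<beta>: "\<beta> \<in> bruhat_generators Q w"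
  shows "0 \<le> f \<bullet> \<beta>"
proof -
  have w: "bij w" using facet_prefix_prod_length[OF Q J(1)] bij_prefix_prod by metis
  obtain K i where K: "K \<in> sc_facets Q w" "i \<in> K" "\<beta> = root_fun Q K i"
    "root_src Q K i < root_tgt Q K i" "(root_src Q K i, root_tgt Q K i) \<notin> invs w"
    by (rule bruhat_generator_is_root[OF Q w \<beta>])
  show ?thesis
    unfolding K(3) by (rule weak_sink_nonflippable_root_nonneg[OF Q J K(1,2) refl refl K(4,5)])
qed

section \<open>Convex geometry\<close>

lemma convex_cone_hull_inner_nonneg:
  assumes "\<And>x. x \<in> X \<Longrightarrow> 0 \<le> g \<bullet> x" and "z \<in> convex_cone hull X"
  shows "0 \<le> g \<bullet> (z :: 'a::real_inner)"
proof -
  have "convex_cone {x. 0 \<le> g \<bullet> x}"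
    by (auto simp: convex_cone_iff inner_add_right)
  then have "convex_cone hull X \<subseteq> {x. 0 \<le> g \<bullet> x}"
    using assms(1) by (intro hull_minimal) auto
  then show ?thesis using assms(2) by auto
qed

lemma convex_cone_hull_separation:
  fixes z :: "'a::euclidean_space"
  assumes "finite X" "z \<notin> convex_cone hull X"
  shows "\<exists>g. g \<bullet> z < 0 \<and> (\<forall>x\<in>X. 0 \<le> g \<bullet> x)"
proof -
  obtain g b where g: "g \<bullet> z < b" "\<And>x. x \<in> convex_cone hull X \<Longrightarrow> b < g \<bullet> x"
    using separating_hyperplane_closed_point[OF convex_convex_cone_hull closed_convex_cone_hull[OF assms(1)] assms(2)]
    by blast
  have "b < 0" using g(2)[OF convex_cone_hull_contains_0] by simp
  have "0 \<le> g \<bullet> x" if "x \<in> X" for x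
  proof (rule ccontr)
    assume neg: "\<not> 0 \<le> g \<bullet> x"
    have "x \<in> convex_cone hull X" using that by (rule hull_inc)
    then have "(b / (g \<bullet> x)) *\<^sub>R x \<in> convex_cone hull X"
      using neg \<open>b < 0\<close> by (intro convex_cone_hull_mul) (auto simp: divide_nonpos_neg)
    from g(2)[OF this] show False using neg by simp
  qed
  moreover have "g \<bullet> z < 0" using g(1) \<open>b < 0\<close> by simp
  ultimately show ?thesis by blast
qed

lemma convex_hull_inner_ge:
  assumes "\<And>s. s \<in> S \<Longrightarrow> c \<le> f \<bullet> s" and "y \<in> convex hull S"
  shows "c \<le> f \<bullet> (y :: 'a::euclidean_space)"
proof -
  have "convex hull S \<subseteq> {x. c \<le> f \<bullet> x}"
    using assms(1) convex_halfspace_ge[of c f] by (intro hull_minimal) auto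
  then show ?thesis using assms(2) by auto
qed

text \<open>
  In a convex combination on which \<open>f\<close> attains its minimum, only minimising points carry weight.
\<close>

lemma convex_hull_minimal_face:
  fixes f :: "'a::euclidean_space"
  assumes "finite S" "\<And>s. s \<in> S \<Longrightarrow> c \<le> f \<bullet> s" "y \<in> convex hull S" "f \<bullet> y = c"
  shows "y \<in> convex hull {s \<in> S. f \<bullet> s = c}"
proof -
  obtain u where u: "\<forall>s\<in>S. 0 \<le> u s" "sum u S = 1" "(\<Sum>s\<in>S. u s *\<^sub>R s) = y"
    using assms(3) unfolding convex_hull_finite[OF assms(1)] by blast
  let ?T = "{s \<in> S. f \<bullet> s = c}"
  have "(\<Sum>s\<in>S. u s * (f \<bullet> s - c)) = f \<bullet> (\<Sum>s\<in>S. u s *\<^sub>R s) - c * sum u S"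
    by (simp add: inner_sum_right right_diff_distrib sum_subtractf sum_distrib_left mult.commute)
  also have "\<dots> = 0" using u assms(4) by simp
  finally have "\<forall>s\<in>S. u s * (f \<bullet> s - c) = 0"
    using u(1) assms(1,2) by (subst (asm) sum_nonneg_eq_0_iff) auto
  then have zero: "u s = 0" if "s \<in> S - ?T" for s using that by auto
  have "sum u ?T = 1"
    using u(2) assms(1) zero by (subst sum.mono_neutral_left[of S ?T u]) auto
  moreover have "(\<Sum>s\<in>?T. u s *\<^sub>R s) = y"
    using u(3) assms(1) zero by (subst sum.mono_neutral_left[of S ?T "\<lambda>s. u s *\<^sub>R s"]) auto
  moreover have "\<forall>s\<in>?T. 0 \<le> u s" using u(1) by blast
  moreover have "finite ?T" using assms(1) by simp
  ultimately show ?thesis unfolding convex_hull_finite[OF \<open>finite ?T\<close>] by blast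
qed

lemma closed_set_plus:
  fixes S :: "'a::real_normed_vector set"
  assumes "compact S" "closed T"
  shows "closed (S + T)"
proof -
  have "S + T = (\<Union>x\<in>S. \<Union>y\<in>T. {x + y})" by (auto simp: set_plus_def)
  then show ?thesis using compact_closed_sums[OF assms] by simp
qed

lemma polyhedron_translate:
  fixes C :: "'a::euclidean_space set"
  assumes "polyhedron C"
  shows "polyhedron {x. x - b \<in> C}"
proof -
  from assms[unfolded polyhedron_def]
  obtain F where F: "finite F" "C = \<Inter> F" "\<forall>h\<in>F. \<exists>a c. a \<noteq> 0 \<and> h = {x. a \<bullet> x \<le> c}"
    by (elim exE conjE)
  have half: "polyhedron {x. x - b \<in> h}" if "h \<in> F" for h
  proof -
    from bspec[OF F(3) that] obtain a c where "h = {x. a \<bullet> x \<le> c}" by (elim exE conjE)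
    then have "{x. x - b \<in> h} = {x. a \<bullet> x \<le> c + a \<bullet> b}" by (simp add: inner_diff_right diff_le_eq)
    then show ?thesis by (simp add: polyhedron_halfspace_le)
  qed
  have "polyhedron (\<Inter> ((\<lambda>h. {x. x - b \<in> h}) ` F))"
    by (rule polyhedron_Inter[OF finite_imageI[OF F(1)]]) (use half in blast)
  moreover have "\<Inter> ((\<lambda>h. {x. x - b \<in> h}) ` F) = {x. x - b \<in> C}" unfolding F(2) by auto
  ultimately show ?thesis by simp
qed

section \<open>Brick polyhedra\<close>

lemma finite_root_conf: "J \<in> sc_facets Q w \<Longrightarrow> finite (root_conf Q I J)"
proof -
  assume "J \<in> sc_facets Q w"
  then have "finite J" by (auto simp: sc_facets_def intro: finite_subset)
  moreover have "root_conf Q I J = root_fun Q J ` (J - I)" by (auto simp: root_conf_def)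
  ultimately show ?thesis by simp
qed

lemma weak_sink_iff_root_conf: "weak_sink Q I f J \<longleftrightarrow> (\<forall>x\<in>root_conf Q I J. 0 \<le> f \<bullet> x)"
  by (auto simp: weak_sink_def root_conf_def)

lemma facets_above_empty: "facets_above Q w {} = sc_facets Q w"
  by (simp add: facets_above_def)

lemma weak_sink_if_brick_min:
  assumes Q: "set Q \<subseteq> simple_indices" and J: "J \<in> facets_above Q w I"
    and gen: "\<forall>\<beta>\<in>bruhat_generators Q w. 0 \<le> f \<bullet> \<beta>"
    and min: "\<forall>K\<in>facets_above Q w I. f \<bullet> brick_vector Q J \<le> f \<bullet> brick_vector Q K"
  shows "weak_sink Q I f J"
  unfolding weak_sink_def
proof
  fix i assume i: "i \<in> J - I"
  have JF: "J \<in> sc_facets Q w" using J by (simp add: facets_above_iff)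
  let ?x = "root_src Q J i" and ?y = "root_tgt Q J i"
  show "0 \<le> f \<bullet> root_fun Q J i"
  proof (cases "(min ?x ?y, max ?x ?y) \<in> invs w")
    case True
    have pair: "{?x, ?y} = {min ?x ?y, max ?x ?y}" by (auto simp: min_def max_def)
    obtain j C where "insert j (J - {i}) \<in> facets_above Q w I"
      "brick_vector Q (insert j (J - {i})) = brick_vector Q J + C *\<^sub>R root_fun Q J i" "(0::real) < C"
      by (rule flip[OF Q J i pair True]) blast
    with bspec[OF min, of "insert j (J - {i})"] show ?thesis
      by (simp add: inner_add_right zero_le_mult_iff)
  next
    case False
    have "i < length Q" using i facet_subset[OF Q JF] by auto
    have "\<not> ?y < ?x"
    proof
      assume "?y < ?x"
      then have "min ?x ?y = ?y" "max ?x ?y = ?x" by (simp_all add: min_absorb2 max_absorb1 less_imp_le)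
      with negative_root_inverted[OF Q JF _ \<open>?y < ?x\<close>] i False show False by simp
    qed
    with root_src_neq_tgt[OF Q \<open>i < length Q\<close>] have "?x < ?y" by (simp add: not_less le_less)
    with False have "(?x, ?y) \<notin> invs w" by (simp add: min_absorb1 max_absorb2 less_imp_le)
    with \<open>?x < ?y\<close> have "root_fun Q J i \<in> bruhat_generators Q w"
      using i by (intro nonflippable_root_generator[OF Q JF _ refl refl]) auto
    then show ?thesis by (rule bspec[OF gen])
  qed
qed

lemma weak_sink_brick_min:
  assumes Q: "set Q \<subseteq> simple_indices"
    and J: "J \<in> facets_above Q w I" "weak_sink Q I f J" and K: "K \<in> facets_above Q w I"
  shows "f \<bullet> brick_vector Q J \<le> f \<bullet> brick_vector Q K"
proof -
  have "(\<Sum>k<length Q. f \<bullet> weight_fun Q K k) \<le> (\<Sum>k<length Q. f \<bullet> weight_fun Q J k)"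
    by (rule sum_mono) (use weak_sink_weight_max[OF Q J K] in simp)
  then show ?thesis by (simp add: brick_vector_def inner_sum_right)
qed

lemma weak_sink_pos_positions_eq:
  assumes Q: "set Q \<subseteq> simple_indices"
    and J: "J \<in> facets_above Q w I" "weak_sink Q I f J"
    and K: "K \<in> facets_above Q w I" "weak_sink Q I f K"
  shows "pos_positions Q I f J = pos_positions Q I f K"
proof -
  obtain J' where J': "J' \<in> facets_above Q w I" "sink Q I (functional_rank f) J'"
    "pos_positions Q I f J' = pos_positions Q I f J"
    by (rule weak_sink_perturb[OF Q J]) blast
  obtain K' where K': "K' \<in> facets_above Q w I" "sink Q I (functional_rank f) K'"
    "pos_positions Q I f K' = pos_positions Q I f K"
    by (rule weak_sink_perturb[OF Q K]) blast
  have "J' = K'" by (rule sink_unique[OF Q inj_functional_rank J'(1,2) K'(1,2)])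
  then show ?thesis using J'(3) K'(3) by simp
qed

lemma brick_polyhedron_eq:
  "brick_polyhedron Q w =
    convex hull (brick_vector Q ` sc_facets Q w) + convex_cone hull bruhat_generators Q w"
  by (simp add: brick_polyhedron_def bruhat_generators_def)

lemma finite_sc_facets: "finite (sc_facets Q w)"
  using finite_facets_above[of Q w "{}"] unfolding facets_above_empty .

lemma brick_vector_plus_generators_in:
  assumes "J \<in> sc_facets Q w" "z \<in> convex_cone hull bruhat_generators Q w"
  shows "brick_vector Q J + z \<in> brick_polyhedron Q w"
  unfolding brick_polyhedron_eq
  by (rule set_plus_intro[OF hull_inc[OF imageI[OF assms(1)]] assms(2)])

lemma generator_nonneg_if_bounded:
  assumes "J \<in> sc_facets Q w" and bound: "\<And>x. x \<in> brick_polyhedron Q w \<Longrightarrow> c \<le> f \<bullet> x"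
    and \<beta>: "\<beta> \<in> bruhat_generators Q w"
  shows "0 \<le> f \<bullet> \<beta>"
proof (rule ccontr)
  assume neg: "\<not> 0 \<le> f \<bullet> \<beta>"
  let ?b = "brick_vector Q J"
  have "0 \<in> convex_cone hull bruhat_generators Q w" by (rule convex_cone_hull_contains_0)
  from brick_vector_plus_generators_in[OF assms(1) this] have ge: "c \<le> f \<bullet> ?b"
    using bound by simp
  define t where "t = (f \<bullet> ?b - c + 1) / - (f \<bullet> \<beta>)"
  have "0 \<le> t" unfolding t_def by (intro divide_nonneg_pos) (use ge neg in auto)
  then have "t *\<^sub>R \<beta> \<in> convex_cone hull bruhat_generators Q w"
    using \<beta> by (intro convex_cone_hull_mul hull_inc)
  from bound[OF brick_vector_plus_generators_in[OF assms(1) this]]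
  have "c \<le> f \<bullet> ?b + t * (f \<bullet> \<beta>)" by (simp add: inner_add_right)
  moreover have "t * (f \<bullet> \<beta>) = - (f \<bullet> ?b - c + 1)" using neg by (simp add: t_def)
  ultimately show False by simp
qed

lemma closed_brick_polyhedron: "closed (brick_polyhedron Q w)"
  unfolding brick_polyhedron_eq
  by (intro closed_set_plus compact_convex_hull finite_imp_compact finite_imageI finite_sc_facets
      closed_convex_cone_hull finite_bruhat_generators)

lemma convex_brick_polyhedron: "convex (brick_polyhedron Q w)"
  unfolding brick_polyhedron_eq by (intro convex_set_plus convex_convex_hull convex_convex_cone_hull)

lemma ex_brick_min:
  assumes "facets_above Q w I \<noteq> {}"
  shows "\<exists>J\<in>facets_above Q w I. \<forall>K\<in>facets_above Q w I. f \<bullet> brick_vector Q J \<le> f \<bullet> brick_vector Q K"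
  using ex_min_on[OF finite_facets_above assms] .

text \<open>
  A functional that separates \<open>x\<close> from the cone at the vertex of \<open>J\<close> is non-negative on the roots of
  \<open>J\<close>. Therefore it is minimal at \<open>J\<close> among the brick vectors and non-negative on the Bruhat cone.
\<close>

lemma brick_polyhedron_local:
  assumes Q: "set Q \<subseteq> simple_indices" and J: "J \<in> sc_facets Q w"
    and x: "x \<in> brick_polyhedron Q w"
  shows "x - brick_vector Q J \<in> convex_cone hull root_conf Q {} J"
proof (rule ccontr)
  assume "x - brick_vector Q J \<notin> convex_cone hull root_conf Q {} J"
  from convex_cone_hull_separation[OF finite_root_conf[OF J] this]
  obtain g where g: "g \<bullet> (x - brick_vector Q J) < 0" "\<forall>x\<in>root_conf Q {} J. 0 \<le> g \<bullet> x"
    by (elim exE conjE)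
  have sink: "weak_sink Q {} g J" using g(2) by (simp only: weak_sink_iff_root_conf)
  have above: "K \<in> facets_above Q w {}" if "K \<in> sc_facets Q w" for K
    using that by (simp only: facets_above_empty)
  obtain y z where yz: "x = y + z" "y \<in> convex hull (brick_vector Q ` sc_facets Q w)"
    "z \<in> convex_cone hull bruhat_generators Q w"
    using x[unfolded brick_polyhedron_eq] by (rule set_plus_elim)
  have "g \<bullet> brick_vector Q J \<le> g \<bullet> s" if "s \<in> brick_vector Q ` sc_facets Q w" for s
    using weak_sink_brick_min[OF Q above[OF J] sink above] that by blast
  from convex_hull_inner_ge[OF this yz(2)] have "g \<bullet> brick_vector Q J \<le> g \<bullet> y" .
  moreover have "0 \<le> g \<bullet> z"
    by (rule convex_cone_hull_inner_nonneg[OF weak_sink_generator_nonneg[OF Q J sink] yz(3)])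
  ultimately show False using g(1) unfolding yz(1) by (simp add: inner_diff_right inner_add_right)
qed

text \<open>
  A functional that separates \<open>x\<close> from the polyhedron is bounded below on it, so it has a minimising
  facet \<open>J\<close>, which is a weak sink. Then \<open>x\<close> cannot lie in the cone at \<open>J\<close>.
\<close>

lemma brick_polyhedron_if_local:
  assumes Q: "set Q \<subseteq> simple_indices" and ne: "sc_facets Q w \<noteq> {}"
    and x: "\<And>J. J \<in> sc_facets Q w \<Longrightarrow> x - brick_vector Q J \<in> convex_cone hull root_conf Q {} J"
  shows "x \<in> brick_polyhedron Q w"
proof (rule ccontr)
  assume notin: "x \<notin> brick_polyhedron Q w"
  from separating_hyperplane_closed_point[OF convex_brick_polyhedron closed_brick_polyhedron this]
  obtain g c where g: "g \<bullet> x < c" "\<forall>y\<in>brick_polyhedron Q w. c < g \<bullet> y"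
    by (elim exE conjE)
  from ex_brick_min[of Q w "{}" g, unfolded facets_above_empty, OF ne]
  obtain J where J: "J \<in> sc_facets Q w"
    and min: "\<forall>K\<in>sc_facets Q w. g \<bullet> brick_vector Q J \<le> g \<bullet> brick_vector Q K" by (elim bexE)
  have bound: "c \<le> g \<bullet> y" if "y \<in> brick_polyhedron Q w" for y
    using g(2) that by (auto intro: less_imp_le)
  have "\<forall>\<beta>\<in>bruhat_generators Q w. 0 \<le> g \<bullet> \<beta>"
    using generator_nonneg_if_bounded[OF J bound] by (intro ballI)
  then have "weak_sink Q {} g J"
    using min J by (intro weak_sink_if_brick_min[OF Q, of J w]) (simp_all only: facets_above_empty)
  then have "0 \<le> g \<bullet> (x - brick_vector Q J)"
    unfolding weak_sink_iff_root_conf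
    by (intro convex_cone_hull_inner_nonneg[OF _ x[OF J]]) (rule bspec)
  moreover have "c < g \<bullet> brick_vector Q J"
    using g(2) brick_vector_plus_generators_in[OF J convex_cone_hull_contains_0]
    unfolding add_0_right by (rule bspec)
  ultimately show False using g(1) by (simp add: inner_diff_right)
qed

lemma brick_polyhedron_eq_Inter:
  assumes Q: "set Q \<subseteq> simple_indices" and ne: "sc_facets Q w \<noteq> {}"
  shows "brick_polyhedron Q w =
    (\<Inter>J\<in>sc_facets Q w. {x. x - brick_vector Q J \<in> convex_cone hull root_conf Q {} J})"
proof (intro set_eqI iffI)
  fix x assume "x \<in> brick_polyhedron Q w"
  then show "x \<in> (\<Inter>J\<in>sc_facets Q w. {x. x - brick_vector Q J \<in> convex_cone hull root_conf Q {} J})"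
    using brick_polyhedron_local[OF Q] by simp
next
  fix x assume "x \<in> (\<Inter>J\<in>sc_facets Q w. {x. x - brick_vector Q J \<in> convex_cone hull root_conf Q {} J})"
  then show "x \<in> brick_polyhedron Q w"
    by (intro brick_polyhedron_if_local[OF Q ne]) simp
qed

lemma polyhedron_brick_polyhedron:
  assumes Q: "set Q \<subseteq> simple_indices" and ne: "sc_facets Q w \<noteq> {}"
  shows "polyhedron (brick_polyhedron Q w)"
  unfolding brick_polyhedron_eq_Inter[OF assms]
proof (rule polyhedron_Inter)
  show "finite ((\<lambda>J. {x. x - brick_vector Q J \<in> convex_cone hull root_conf Q {} J}) ` sc_facets Q w)"
    by (intro finite_imageI finite_sc_facets)
  show "polyhedron S"
    if S: "S \<in> (\<lambda>J. {x. x - brick_vector Q J \<in> convex_cone hull root_conf Q {} J}) ` sc_facets Q w" for S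
  proof -
    from S obtain J where J: "J \<in> sc_facets Q w"
      "S = {x. x - brick_vector Q J \<in> convex_cone hull root_conf Q {} J}" by (rule imageE)
    show ?thesis
      unfolding J(2) by (rule polyhedron_translate[OF polyhedron_convex_cone_hull[OF finite_root_conf[OF J(1)]]])
  qed
qed

section \<open>Faces of the brick polyhedron\<close>

text \<open>
  If \<open>K\<close> contains \<open>I = pos_positions Q {} f J\<close>, compare \<open>K\<close> and \<open>J\<close> with the positions of \<open>I\<close> fixed. The
  remaining roots of \<open>J\<close> have \<open>f\<close>-value \<open>0\<close>, so \<open>J\<close> is a weak sink for both \<open>f\<close> and \<open>- f\<close>. Conversely, a
  minimising \<open>K\<close> is a weak sink and shares its positions of positive roots with \<open>J\<close>.
\<close>

lemma facets_above_iff_brick_min: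
  assumes Q: "set Q \<subseteq> simple_indices" and J: "J \<in> sc_facets Q w"
    and gen: "\<forall>\<beta>\<in>bruhat_generators Q w. 0 \<le> f \<bullet> \<beta>"
    and min: "\<forall>K\<in>sc_facets Q w. f \<bullet> brick_vector Q J \<le> f \<bullet> brick_vector Q K"
    and K: "K \<in> sc_facets Q w"
  shows "pos_positions Q {} f J \<subseteq> K \<longleftrightarrow> f \<bullet> brick_vector Q K = f \<bullet> brick_vector Q J"
    and "f \<bullet> brick_vector Q K = f \<bullet> brick_vector Q J \<Longrightarrow>
      weak_sink Q {} f K \<and> pos_positions Q {} f K = pos_positions Q {} f J"
proof -
  have sinks: "weak_sink Q {} f L" if L: "L \<in> sc_facets Q w" "f \<bullet> brick_vector Q L = f \<bullet> brick_vector Q J" for L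
    using min L gen by (intro weak_sink_if_brick_min[OF Q, of L w]) (simp_all only: facets_above_empty)
  have fJ: "weak_sink Q {} f J" by (rule sinks[OF J refl])
  show eq: "weak_sink Q {} f K \<and> pos_positions Q {} f K = pos_positions Q {} f J"
    if "f \<bullet> brick_vector Q K = f \<bullet> brick_vector Q J"
  proof
    show fK: "weak_sink Q {} f K" by (rule sinks[OF K that])
    show "pos_positions Q {} f K = pos_positions Q {} f J"
      by (rule weak_sink_pos_positions_eq[OF Q _ fK _ fJ, of w]) (simp_all only: facets_above_empty J K)
  qed
  let ?I = "pos_positions Q {} f J"
  have IJ: "?I \<subseteq> J" by (auto simp: pos_positions_def)
  show "?I \<subseteq> K \<longleftrightarrow> f \<bullet> brick_vector Q K = f \<bullet> brick_vector Q J"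
  proof
    assume "?I \<subseteq> K"
    then have above: "J \<in> facets_above Q w ?I" "K \<in> facets_above Q w ?I"
      using J K IJ by (simp_all add: facets_above_iff)
    have "weak_sink Q ?I f J" "weak_sink Q ?I (- f) J"
      using fJ by (auto simp: weak_sink_def pos_positions_def not_less)
    from weak_sink_brick_min[OF Q above(1) this(1) above(2)] weak_sink_brick_min[OF Q above(1) this(2) above(2)]
    show "f \<bullet> brick_vector Q K = f \<bullet> brick_vector Q J" by simp
  next
    assume "f \<bullet> brick_vector Q K = f \<bullet> brick_vector Q J"
    from eq[OF this] show "?I \<subseteq> K" by (auto simp: pos_positions_def)
  qed
qed

text \<open>
  Both inclusions are proved by separation. If \<open>z\<close> is outside the Bruhat cone, minimise the separating
  functional over the facets that contain \<open>I\<close>; the minimiser is a weak sink for it relative to \<open>I\<close>. If \<open>z\<close> is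
  outside the cone at some \<open>K\<close>, add a multiple of \<open>f\<close>, which vanishes at \<open>z\<close>, to make \<open>K\<close> a weak
  sink; then the functional is non-negative on the whole Bruhat cone.
\<close>

lemma root_cone_eq:
  assumes Q: "set Q \<subseteq> simple_indices" and J: "J \<in> facets_above Q w I"
    and pos: "\<And>K. K \<in> facets_above Q w I \<Longrightarrow> weak_sink Q {} f K \<and> pos_positions Q {} f K = I"
  shows "root_cone Q w I = {z \<in> convex_cone hull bruhat_generators Q w. f \<bullet> z = 0}"
proof (intro set_eqI iffI)
  fix z
  assume z: "z \<in> root_cone Q w I"
  have z_in: "z \<in> convex_cone hull root_conf Q I K" if "K \<in> facets_above Q w I" for K
    using z that by (auto simp: root_cone_def)
  have "f \<bullet> x = 0" if "x \<in> root_conf Q I J" for x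
    using that pos[OF J] by (force simp: root_conf_def weak_sink_def pos_positions_def)
  then have "0 \<le> f \<bullet> x" "0 \<le> (- f) \<bullet> x" if "x \<in> root_conf Q I J" for x
    using that by simp_all
  then have "0 \<le> f \<bullet> z" "0 \<le> (- f) \<bullet> z"
    using convex_cone_hull_inner_nonneg[OF _ z_in[OF J]] by blast+
  moreover have "z \<in> convex_cone hull bruhat_generators Q w"
  proof (rule ccontr)
    assume "z \<notin> convex_cone hull bruhat_generators Q w"
    from convex_cone_hull_separation[OF finite_bruhat_generators this]
    obtain g where g: "g \<bullet> z < 0" "\<forall>\<beta>\<in>bruhat_generators Q w. 0 \<le> g \<bullet> \<beta>" by (elim exE conjE)
    have "facets_above Q w I \<noteq> {}" using J by blast
    from ex_brick_min[OF this, of g] obtain K where K: "K \<in> facets_above Q w I"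
      "\<forall>L\<in>facets_above Q w I. g \<bullet> brick_vector Q K \<le> g \<bullet> brick_vector Q L" by (elim bexE)
    have "weak_sink Q I g K" by (rule weak_sink_if_brick_min[OF Q K(1) g(2) K(2)])
    then have "0 \<le> g \<bullet> z"
      unfolding weak_sink_iff_root_conf
      by (intro convex_cone_hull_inner_nonneg[OF _ z_in[OF K(1)]]) (rule bspec)
    then show False using g(1) by simp
  qed
  ultimately show "z \<in> {z \<in> convex_cone hull bruhat_generators Q w. f \<bullet> z = 0}" by simp
next
  fix z
  assume "z \<in> {z \<in> convex_cone hull bruhat_generators Q w. f \<bullet> z = 0}"
  then have z: "z \<in> convex_cone hull bruhat_generators Q w" "f \<bullet> z = 0" by simp_all
  have "z \<in> convex_cone hull root_conf Q I K" if K: "K \<in> facets_above Q w I" for K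
  proof (rule ccontr)
    have KF: "K \<in> sc_facets Q w" using K by (simp add: facets_above_iff)
    assume "z \<notin> convex_cone hull root_conf Q I K"
    from convex_cone_hull_separation[OF finite_root_conf[OF KF] this]
    obtain g where g: "g \<bullet> z < 0" "\<forall>x\<in>root_conf Q I K. 0 \<le> g \<bullet> x" by (elim exE conjE)
    \<comment> \<open>A large multiple of \<open>f\<close> makes \<open>g\<close> non-negative on the roots at \<open>I\<close> as well.\<close>
    let ?q = "\<lambda>i. \<bar>g \<bullet> root_fun Q K i\<bar> / (f \<bullet> root_fun Q K i)"
    define N where "N = (\<Sum>i\<in>I. ?q i)"
    have fpos: "0 < f \<bullet> root_fun Q K i" if "i \<in> I" for i
      using that pos[OF K] by (auto simp: pos_positions_def)
    have "finite I"
      using K by (auto simp: facets_above_def sc_facets_def intro: finite_subset)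
    have "0 \<le> N" unfolding N_def using fpos by (intro sum_nonneg divide_nonneg_pos) auto
    let ?h = "g + N *\<^sub>R f"
    have "weak_sink Q {} ?h K"
      unfolding weak_sink_def
    proof
      fix i assume i: "i \<in> K - {}"
      show "0 \<le> ?h \<bullet> root_fun Q K i"
      proof (cases "i \<in> I")
        case True
        have "?q i \<le> N"
          unfolding N_def using \<open>finite I\<close> True fpos
          by (intro member_le_sum divide_nonneg_pos) auto
        then have "\<bar>g \<bullet> root_fun Q K i\<bar> \<le> N * (f \<bullet> root_fun Q K i)"
          using fpos[OF True] by (simp add: pos_divide_le_eq)
        then show ?thesis by (simp add: inner_add_left)
      next
        case False
        then have "0 \<le> g \<bullet> root_fun Q K i" using g(2) i by (auto simp: root_conf_def)
        moreover have "0 \<le> f \<bullet> root_fun Q K i" using pos[OF K] i by (auto simp: weak_sink_def)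
        ultimately show ?thesis using \<open>0 \<le> N\<close> by (simp add: inner_add_left)
      qed
    qed
    from convex_cone_hull_inner_nonneg[OF weak_sink_generator_nonneg[OF Q KF this] z(1)]
    show False using g(1) z(2) by (simp add: inner_add_left)
  qed
  then show "z \<in> root_cone Q w I" by (auto simp: root_cone_def)
qed

theorem proposition5p5:
  fixes Q :: "'n::{finite,linorder} list"
    and w :: "'n \<Rightarrow> 'n"
    and F :: "((real, 'n) vec) set"
  assumes "set Q \<subseteq> simple_indices"
    and "w \<in> sym_group"
    and "subword_complex Q w \<noteq> {}"
    and "F face_of brick_polyhedron Q w"
    and "F \<noteq> {}"
  shows "\<exists>I\<in>subword_complex Q w. F = modified_brick_polyhedron Q w I"
proof -
  note Q = assms(1)
  let ?B = "brick_polyhedron Q w" and ?b = "brick_vector Q" and ?S = "sc_facets Q w"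
    and ?C = "convex_cone hull bruhat_generators Q w"
  have ne: "?S \<noteq> {}" using assms(3) by (auto simp: subword_complex_def)
  have "F exposed_face_of ?B"
    using exposed_face_of_polyhedron[OF polyhedron_brick_polyhedron[OF Q ne]] assms(4) by blast
  then obtain a b where ab: "?B \<subseteq> {x. a \<bullet> x \<le> b}" "F = ?B \<inter> {x. a \<bullet> x = b}"
    unfolding exposed_face_of_def by blast
  define f c where "f = - a" and "c = - b"
  have bound: "c \<le> f \<bullet> x" if "x \<in> ?B" for x using ab(1) that by (auto simp: f_def c_def)
  have F: "x \<in> F \<longleftrightarrow> x \<in> ?B \<and> f \<bullet> x = c" for x using ab(2) by (auto simp: f_def c_def)
  from ex_brick_min[of Q w "{}" f, unfolded facets_above_empty, OF ne]
  obtain J where J: "J \<in> ?S" and min: "\<forall>K\<in>?S. f \<bullet> ?b J \<le> f \<bullet> ?b K" by (elim bexE)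
  have gen: "\<forall>\<beta>\<in>bruhat_generators Q w. 0 \<le> f \<bullet> \<beta>"
    using generator_nonneg_if_bounded[OF J bound] by (intro ballI)
  have cone_ge: "0 \<le> f \<bullet> z" if "z \<in> ?C" for z
    by (rule convex_cone_hull_inner_nonneg[OF bspec[OF gen] that])
  have conv_ge: "f \<bullet> ?b J \<le> f \<bullet> y" if "y \<in> convex hull (?b ` ?S)" for y
  proof (rule convex_hull_inner_ge[OF _ that])
    fix s assume "s \<in> ?b ` ?S"
    then obtain K where "K \<in> ?S" "s = ?b K" by (elim imageE)
    then show "f \<bullet> ?b J \<le> f \<bullet> s" using bspec[OF min] by simp
  qed
  have c: "f \<bullet> ?b J = c"
  proof (rule antisym)
    obtain x where "x \<in> F" using assms(5) by blast
    then have x: "x \<in> ?B" "f \<bullet> x = c" using F by blast+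
    obtain y z where "x = y + z" "y \<in> convex hull (?b ` ?S)" "z \<in> ?C"
      using x(1)[unfolded brick_polyhedron_eq] by (rule set_plus_elim)
    then show "f \<bullet> ?b J \<le> c" using x(2) cone_ge[of z] conv_ge[of y] by (simp add: inner_add_right)
    show "c \<le> f \<bullet> ?b J"
      using bound[OF brick_vector_plus_generators_in[OF J convex_cone_hull_contains_0]] by simp
  qed
  define I where "I = pos_positions Q {} f J"
  have "I \<subseteq> J" by (auto simp: I_def pos_positions_def)
  note char = facets_above_iff_brick_min[OF Q J gen min, folded I_def, unfolded c]
  have above: "facets_above Q w I = {K \<in> ?S. f \<bullet> ?b K = c}"
    using char(1) by (auto simp: facets_above_iff)
  have pos: "weak_sink Q {} f K \<and> pos_positions Q {} f K = I" if "K \<in> facets_above Q w I" for K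
  proof -
    from that have K: "K \<in> ?S" "f \<bullet> ?b K = c" unfolding above by blast+
    show ?thesis by (rule char(2)[OF K])
  qed
  have "J \<in> facets_above Q w I" using J \<open>I \<subseteq> J\<close> by (simp add: facets_above_iff)
  then have rc: "root_cone Q w I = {z \<in> ?C. f \<bullet> z = 0}"
    by (rule root_cone_eq[OF Q _ pos])
  have vert: "?b ` facets_above Q w I = {s \<in> ?b ` ?S. f \<bullet> s = c}" unfolding above by blast
  have "F = modified_brick_polyhedron Q w I"
  proof (intro set_eqI iffI)
    fix x assume "x \<in> F"
    then have x: "x \<in> ?B" "f \<bullet> x = c" using F by blast+
    obtain y z where yz: "x = y + z" "y \<in> convex hull (?b ` ?S)" "z \<in> ?C"
      using x(1)[unfolded brick_polyhedron_eq] by (rule set_plus_elim)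
    then have fyz: "f \<bullet> y = c" "f \<bullet> z = 0"
      using x(2) cone_ge[of z] conv_ge[of y] c by (simp_all add: inner_add_right)
    have "y \<in> convex hull {s \<in> ?b ` ?S. f \<bullet> s = c}"
      by (rule convex_hull_minimal_face[OF finite_imageI[OF finite_sc_facets] _ yz(2) fyz(1)])
        (use min c in auto)
    moreover have "z \<in> root_cone Q w I" unfolding rc using yz(3) fyz(2) by blast
    ultimately show "x \<in> modified_brick_polyhedron Q w I"
      unfolding modified_brick_polyhedron_def vert yz(1) by (rule set_plus_intro)
  next
    fix x assume "x \<in> modified_brick_polyhedron Q w I"
    then obtain y z where yz: "x = y + z" "y \<in> convex hull {s \<in> ?b ` ?S. f \<bullet> s = c}" "z \<in> root_cone Q w I"
      unfolding modified_brick_polyhedron_def vert by (rule set_plus_elim)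
    have z: "z \<in> ?C" "f \<bullet> z = 0" using yz(3) unfolding rc by blast+
    have y: "y \<in> convex hull (?b ` ?S)"
      using hull_mono[of "{s \<in> ?b ` ?S. f \<bullet> s = c}" "?b ` ?S" convex] yz(2) by blast
    have "c \<le> f \<bullet> y" "- c \<le> (- f) \<bullet> y"
      by (rule convex_hull_inner_ge[OF _ yz(2)], simp)+
    then have "f \<bullet> y = c" by simp
    moreover have "x \<in> ?B" unfolding brick_polyhedron_eq yz(1) by (rule set_plus_intro[OF y z(1)])
    ultimately show "x \<in> F" unfolding F using z(2) yz(1) by (simp add: inner_add_right)
  qed
  moreover have "I \<in> subword_complex Q w" using J \<open>I \<subseteq> J\<close> by (auto simp: subword_complex_def)
  ultimately show ?thesis by blast
qed

end
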